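(* Let $\Pi:\mathcal X_n\to\widehat{\mathcal X}_n$ be the quotient projection of the symmetric hyperelliptic curve by the involution $\rho$ (defined in the context). The pullback map $\Pi^*:H^{1,0}(\widehat{\mathcal X}_n)\to H^{1,0}(\mathcal X_n)$ is an isomorphism from $H^{1,0}(\widehat{\mathcal X}_n)$ onto the invariant subspace $$H^{1,0}(\mathcal X_n)^\rho:=\{\omega\in H^{1,0}(\mathcal X_n):\rho^*\omega=\omega\}.$$ In particular, $\dim H^{1,0}(\mathcal X_n)^\rho=n$.
   Context: Let $n\ge1$ and let $E_1,\dots,E_{n+1}$ be distinct points in the open first quadrant such that the $2n+2$ points $E_1^2,\dots,E_{n+1}^2,\bar E_1^2,\dots,\bar E_{n+1}^2$ are distinct and nonzero. $\mathcal X_n$ is the compact hyperelliptic Riemann surface (genus $2n+1$) of $$\mathcal R^2=\prod_{j=1}^{n+1}(z^2-E_j^2)(z^2-\bar E_j^2),$$ $\rho(z,\mathcal R)=(-z,\mathcal R)$ its holomorphic involution, $\widehat{\mathcal X}_n=\mathcal X_n/\rho$ the quotient, which is the compact hyperelliptic Riemann surface (genus $n$) of $\widehat{\mathcal R}^2=\prod_{j=1}^{n+1}(\lambda-E_j^2)(\lambda-\bar E_j^2)$, and $\Pi(z,\mathcal R)=(z^2,\mathcal R)$ with $\lambda=z^2$, $\widehat{\mathcal R}=\mathcal R$. $H^{1,0}$ denotes the space of holomorphic differentials. *)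

theory Defs
  imports "HOL-Complex_Analysis.Complex_Analysis" "HOL-Library.Function_Algebras"
begin

section \<open>Surfaces with an atlas and holomorphic differentials\<close>

text \<open>A chart is a domain together with a coordinate map; only the values of the coordinate map on
  the domain matter.\<close>

type_synonym 'a chart = "'a set \<times> ('a \<Rightarrow> complex)"

record 'a surface =
  surface_topology :: "'a topology"
  atlas :: "'a chart set"

text \<open>A differential is given by its coefficient functions: at a point \<open>p\<close> of a chart
  \<open>c = (U, \<phi>)\<close> it is \<open>\<omega> c p d\<phi>\<close>.  The coefficients are 0 outside their proper domain, so
  that equality of differentials is equality of functions.\<close>

type_synonym 'a differential = "'a chart \<Rightarrow> 'a \<Rightarrow> complex"

definition holomorphic_differentials :: "'a surface \<Rightarrow> 'a differential set" where
  "holomorphic_differentials S =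
    {\<omega>. (\<forall>c p. \<not> (c \<in> atlas S \<and> p \<in> fst c) \<longrightarrow> \<omega> c p = 0) \<and>
        (\<forall>(U, \<phi>) \<in> atlas S. (\<omega> (U, \<phi>) \<circ> inv_into U \<phi>) holomorphic_on \<phi> ` U) \<and>
        (\<forall>(U, \<phi>) \<in> atlas S. \<forall>(V, \<psi>) \<in> atlas S. \<forall>p \<in> U \<inter> V.
           \<omega> (U, \<phi>) p = \<omega> (V, \<psi>) p * deriv (\<psi> \<circ> inv_into U \<phi>) (\<phi> p))}"

definition chart_at :: "'a surface \<Rightarrow> 'a \<Rightarrow> 'a chart" where
  "chart_at S p = (SOME c. c \<in> atlas S \<and> p \<in> fst c)"

text \<open>The pullback of \<open>\<omega>\<close> from \<open>T\<close> to \<open>S\<close> along \<open>F\<close>.  For \<open>F\<close> holomorphic and \<open>\<omega>\<close> a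
  holomorphic differential the value does not depend on the chart of \<open>T\<close> chosen around \<open>F p\<close>,
  by the transformation law of the coefficients.\<close>

definition pullback ::
    "'a surface \<Rightarrow> 'b surface \<Rightarrow> ('a \<Rightarrow> 'b) \<Rightarrow> 'b differential \<Rightarrow> 'a differential" where
  "pullback S T F \<omega> = (\<lambda>c p.
     if c \<in> atlas S \<and> p \<in> fst c
     then let d = chart_at T (F p)
          in \<omega> d (F p) * deriv (snd d \<circ> F \<circ> inv_into (fst c) (snd c)) (snd c p)
     else 0)"

definition invariant_differentials :: "'a surface \<Rightarrow> ('a \<Rightarrow> 'a) \<Rightarrow> 'a differential set" where
  "invariant_differentials S \<rho> =
    {\<omega> \<in> holomorphic_differentials S. pullback S S \<rho> \<omega> = \<omega>}"

definition scale_diff :: "complex \<Rightarrow> 'a differential \<Rightarrow> 'a differential" where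
  "scale_diff a \<omega> = (\<lambda>c p. a * \<omega> c p)"

interpretation diff: vector_space "scale_diff :: complex \<Rightarrow> 'a differential \<Rightarrow> 'a differential"
  by unfold_locales (auto simp: scale_diff_def plus_fun_def fun_eq_iff algebra_simps)

definition complex_linear_iso_onto ::
    "('a differential \<Rightarrow> 'b differential) \<Rightarrow> 'a differential set \<Rightarrow> 'b differential set \<Rightarrow> bool" where
  "complex_linear_iso_onto L V W \<longleftrightarrow>
     diff.subspace V \<and> diff.subspace W \<and>
     (\<forall>\<omega> \<in> V. \<forall>\<eta> \<in> V. L (\<omega> + \<eta>) = L \<omega> + L \<eta>) \<and>
     (\<forall>a. \<forall>\<omega> \<in> V. L (scale_diff a \<omega>) = scale_diff a (L \<omega>)) \<and>
     bij_betw L V W"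


section \<open>Compact hyperelliptic curves\<close>

text \<open>For \<open>f\<close> of even degree \<open>2k\<close>, the compact curve of \<open>w\<^sup>2 = f(z)\<close> is glued from the affine curve
  \<open>w\<^sup>2 = f(z)\<close> and the affine curve \<open>v\<^sup>2 = u^(2k) f(1/u)\<close> along \<open>u = 1/z\<close>, \<open>v = w/z^k\<close>.
  \<open>Infinity v\<close> is the point \<open>u = 0\<close> of the second one, with \<open>v\<^sup>2\<close> the leading coefficient.\<close>

datatype curve_point = Affine complex complex | Infinity complex

definition affine_curve :: "complex poly \<Rightarrow> (complex \<times> complex) set" where
  "affine_curve f = {(x, y). y ^ 2 = poly f x}"

fun affine_patch :: "complex \<times> complex \<Rightarrow> curve_point" where
  "affine_patch (z, w) = Affine z w"

fun infinity_patch :: "complex poly \<Rightarrow> complex \<times> complex \<Rightarrow> curve_point" where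
  "infinity_patch f (u, v) =
     (if u = 0 then Infinity v else Affine (1 / u) (v / u ^ (degree f div 2)))"

definition curve_points :: "complex poly \<Rightarrow> curve_point set" where
  "curve_points f =
     affine_patch ` affine_curve f \<union> infinity_patch f ` affine_curve (reflect_poly f)"

definition curve_topology :: "complex poly \<Rightarrow> curve_point topology" where
  "curve_topology f = topology (\<lambda>S. S \<subseteq> curve_points f \<and>
     openin (top_of_set (affine_curve f)) {x \<in> affine_curve f. affine_patch x \<in> S} \<and>
     openin (top_of_set (affine_curve (reflect_poly f)))
       {x \<in> affine_curve (reflect_poly f). infinity_patch f x \<in> S})"

text \<open>The value of \<open>z_coord\<close> and \<open>w_coord\<close> at infinity is irrelevant: the charts below
  use them on affine points only.  \<open>u_coord\<close> is \<open>1/z\<close>.\<close>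

fun z_coord :: "curve_point \<Rightarrow> complex" where
  "z_coord (Affine z w) = z"
| "z_coord (Infinity v) = 0"

fun w_coord :: "curve_point \<Rightarrow> complex" where
  "w_coord (Affine z w) = w"
| "w_coord (Infinity v) = 0"

fun u_coord :: "curve_point \<Rightarrow> complex" where
  "u_coord (Affine z w) = 1 / z"
| "u_coord (Infinity v) = 0"

text \<open>The holomorphic atlas given by the implicit function theorem (for \<open>f\<close> squarefree of even
  degree): \<open>z\<close> is a local coordinate at affine points with \<open>w \<noteq> 0\<close>, \<open>w\<close> at
  affine points with \<open>f'(z) \<noteq> 0\<close> (among them the branch points), and \<open>u = 1/z\<close> near infinity.\<close>

definition curve_atlas :: "complex poly \<Rightarrow> curve_point chart set" where
  "curve_atlas f =
     {(U, z_coord) | U. openin (curve_topology f) U \<and> inj_on z_coord U \<and>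
        U \<subseteq> {Affine z w | z w. w \<noteq> 0}} \<union>
     {(U, w_coord) | U. openin (curve_topology f) U \<and> inj_on w_coord U \<and>
        U \<subseteq> {Affine z w | z w. poly (pderiv f) z \<noteq> 0}} \<union>
     {(U, u_coord) | U. openin (curve_topology f) U \<and> inj_on u_coord U \<and>
        U \<subseteq> range Infinity \<union> {Affine z w | z w. z \<noteq> 0 \<and> w \<noteq> 0}}"

definition hyperelliptic_curve :: "complex poly \<Rightarrow> curve_point surface" where
  "hyperelliptic_curve f = \<lparr>surface_topology = curve_topology f, atlas = curve_atlas f\<rparr>"


section \<open>The symmetric curve and its quotient\<close>

definition sym_poly :: "nat \<Rightarrow> (nat \<Rightarrow> complex) \<Rightarrow> complex poly" where
  "sym_poly n E = (\<Prod>j = 1..n + 1. [:- ((E j)\<^sup>2), 0, 1:] * [:- ((cnj (E j))\<^sup>2), 0, 1:])"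

definition quot_poly :: "nat \<Rightarrow> (nat \<Rightarrow> complex) \<Rightarrow> complex poly" where
  "quot_poly n E = (\<Prod>j = 1..n + 1. [:- ((E j)\<^sup>2), 1:] * [:- ((cnj (E j))\<^sup>2), 1:])"

definition sym_curve :: "nat \<Rightarrow> (nat \<Rightarrow> complex) \<Rightarrow> curve_point surface" where
  "sym_curve n E = hyperelliptic_curve (sym_poly n E)"

definition quot_curve :: "nat \<Rightarrow> (nat \<Rightarrow> complex) \<Rightarrow> curve_point surface" where
  "quot_curve n E = hyperelliptic_curve (quot_poly n E)"

text \<open>The values at infinity are the continuous extensions: on the symmetric curve
  \<open>v = w/z^(2n+2)\<close>, which is unchanged under \<open>z \<mapsto> -z\<close> and equals \<open>w/\<lambda>^(n+1)\<close> for \<open>\<lambda> = z\<^sup>2\<close>.\<close>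

fun curve_involution :: "curve_point \<Rightarrow> curve_point" where
  "curve_involution (Affine z w) = Affine (- z) w"
| "curve_involution (Infinity v) = Infinity v"

fun quot_proj :: "curve_point \<Rightarrow> curve_point" where
  "quot_proj (Affine z w) = Affine (z\<^sup>2) w"
| "quot_proj (Infinity v) = Infinity v"


subsection \<open>Basic facts\<close>

lemma openin_curve_topology:
  "openin (curve_topology f) S \<longleftrightarrow> S \<subseteq> curve_points f \<and>
     openin (top_of_set (affine_curve f)) {x \<in> affine_curve f. affine_patch x \<in> S} \<and>
     openin (top_of_set (affine_curve (reflect_poly f)))
       {x \<in> affine_curve (reflect_poly f). infinity_patch f x \<in> S}"
proof -
  let ?P = "\<lambda>S. S \<subseteq> curve_points f \<and>
     openin (top_of_set (affine_curve f)) {x \<in> affine_curve f. affine_patch x \<in> S} \<and>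
     openin (top_of_set (affine_curve (reflect_poly f)))
       {x \<in> affine_curve (reflect_poly f). infinity_patch f x \<in> S}"
  have pre_Int: "{x \<in> A. h x \<in> S \<inter> T} = {x \<in> A. h x \<in> S} \<inter> {x \<in> A. h x \<in> T}"
    for A :: "(complex \<times> complex) set" and h :: "complex \<times> complex \<Rightarrow> curve_point" and S T
    by auto
  have pre_Un: "{x \<in> A. h x \<in> \<Union>K} = \<Union>((\<lambda>S. {x \<in> A. h x \<in> S}) ` K)"
    for A :: "(complex \<times> complex) set" and h :: "complex \<times> complex \<Rightarrow> curve_point" and K
    by auto
  have "istopology ?P"
    unfolding istopology_def pre_Int pre_Un by (auto intro!: openin_Union)
  then show ?thesis
    by (simp add: curve_topology_def topology_inverse')
qed

lemma topspace_curve_topology [simp]: "topspace (curve_topology f) = curve_points f"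
proof
  show "topspace (curve_topology f) \<subseteq> curve_points f"
    by (metis openin_curve_topology openin_topspace)
  have "{x \<in> affine_curve f. affine_patch x \<in> curve_points f} = affine_curve f"
    "{x \<in> affine_curve (reflect_poly f). infinity_patch f x \<in> curve_points f}
      = affine_curve (reflect_poly f)"
    unfolding curve_points_def by blast+
  then have "openin (curve_topology f) (curve_points f)"
    by (simp add: openin_curve_topology)
  then show "curve_points f \<subseteq> topspace (curve_topology f)"
    by (rule openin_subset)
qed

lemma poly_sym_poly: "poly (sym_poly n E) z = poly (quot_poly n E) (z\<^sup>2)"
  unfolding sym_poly_def quot_poly_def poly_prod poly_mult
  by (intro prod.cong refl) (simp add: power2_eq_square)

lemma degree_quot_poly: "degree (quot_poly n E) = 2 * (n + 1)"
  unfolding quot_poly_def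
  by (subst degree_prod_eq_sum_degree) (auto simp: degree_mult_eq)

lemma degree_sym_poly: "degree (sym_poly n E) = 4 * (n + 1)"
  unfolding sym_poly_def
  by (subst degree_prod_eq_sum_degree) (auto simp: degree_mult_eq)

lemma lead_coeff_quot_poly: "lead_coeff (quot_poly n E) = 1"
  unfolding quot_poly_def lead_coeff_prod lead_coeff_mult by simp

lemma lead_coeff_sym_poly: "lead_coeff (sym_poly n E) = 1"
  unfolding sym_poly_def lead_coeff_prod lead_coeff_mult by simp

lemma poly_reflect_sym_poly:
  "poly (reflect_poly (sym_poly n E)) u = poly (reflect_poly (quot_poly n E)) (u\<^sup>2)"
proof (cases "u = 0")
  case True
  then show ?thesis
    using lead_coeff_quot_poly[of n E] lead_coeff_sym_poly[of n E] by (simp add: poly_0_coeff_0)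
next
  case False
  have e: "4 * (n + 1) = 2 * (2 * (n + 1))" by simp
  show ?thesis
    using False
    by (simp only: poly_reflect_poly_nz power_not_zero not_False_eq_True degree_quot_poly degree_sym_poly
        poly_sym_poly power_inverse e power_mult)
qed

lemma affine_mem_curve_points:
  assumes "even (degree f)"
  shows "Affine z w \<in> curve_points f \<longleftrightarrow> w\<^sup>2 = poly f z"
proof -
  have "w\<^sup>2 = poly f z"
    if "v\<^sup>2 = poly (reflect_poly f) u" "u \<noteq> 0" "z = 1 / u" "w = v / u ^ (degree f div 2)" for u v
  proof -
    have "w\<^sup>2 = v\<^sup>2 / u ^ degree f"
      using that assms by (simp add: power_divide flip: power_mult)
    then show ?thesis
      using that by (simp add: poly_reflect_poly_nz inverse_eq_divide)
  qed
  then show ?thesis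
    by (force simp: curve_points_def affine_curve_def split: if_splits)
qed

lemma infinity_mem_curve_points:
  "Infinity v \<in> curve_points f \<longleftrightarrow> v\<^sup>2 = lead_coeff f"
proof
  assume "v\<^sup>2 = lead_coeff f"
  then have "(0, v) \<in> affine_curve (reflect_poly f)"
    by (simp add: affine_curve_def poly_0_coeff_0)
  then show "Infinity v \<in> curve_points f"
    unfolding curve_points_def by (intro UnI2 image_eqI[of _ _ "(0, v)"]) auto
qed (auto simp: curve_points_def affine_curve_def poly_0_coeff_0 split: if_splits)

lemma curve_points_sym_iff:
  "p \<in> curve_points (sym_poly n E) \<longleftrightarrow> quot_proj p \<in> curve_points (quot_poly n E)"
  using lead_coeff_quot_poly[of n E] lead_coeff_sym_poly[of n E]
  by (cases p) (auto simp: affine_mem_curve_points infinity_mem_curve_points poly_sym_poly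
      degree_sym_poly degree_quot_poly)

lemma curve_involution_in_curve:
  "p \<in> curve_points (sym_poly n E) \<Longrightarrow> curve_involution p \<in> curve_points (sym_poly n E)"
  by (cases p) (auto simp: curve_points_sym_iff)

lemma curve_involution_involution [simp]: "curve_involution (curve_involution p) = p"
  by (cases p) auto

lemma quot_proj_eq_iff: "quot_proj p = quot_proj q \<longleftrightarrow> q = p \<or> q = curve_involution p"
  by (cases p; cases q) (auto simp: power2_eq_iff)

lemma quot_proj_surj: "quot_proj ` curve_points (sym_poly n E) = curve_points (quot_poly n E)"
proof
  show "curve_points (quot_poly n E) \<subseteq> quot_proj ` curve_points (sym_poly n E)"
  proof
    fix q assume q: "q \<in> curve_points (quot_poly n E)"
    have "\<exists>p. quot_proj p = q"
    proof (cases q)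
      case (Affine z w)
      then show ?thesis by (intro exI[of _ "Affine (csqrt z) w"]) simp
    next
      case (Infinity v)
      then show ?thesis by (intro exI[of _ "Infinity v"]) simp
    qed
    then show "q \<in> quot_proj ` curve_points (sym_poly n E)"
      using q by (auto simp: curve_points_sym_iff)
  qed
qed (auto simp: curve_points_sym_iff)

lemma open_square_image:
  assumes "open O'"
  shows "open ((\<lambda>(x :: complex, y :: complex). (x\<^sup>2, y)) ` O')"
proof (subst open_prod_def, safe)
  fix x y assume "(x, y) \<in> O'"
  then obtain A B where AB: "open A" "open B" "x \<in> A" "y \<in> B" "A \<times> B \<subseteq> O'"
    using assms by (metis mem_Sigma_iff open_prod_elim)
  have "open ((\<lambda>x. x\<^sup>2) ` A)"
  proof (rule open_mapping_thm[of _ UNIV])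
    show "\<not> (\<lambda>x :: complex. x\<^sup>2) constant_on UNIV"
      unfolding constant_on_def by (metis UNIV_I one_power2 zero_power2 zero_neq_one)
  qed (use AB in \<open>auto intro!: holomorphic_intros\<close>)
  moreover have "(\<lambda>x. x\<^sup>2) ` A \<times> B \<subseteq> (\<lambda>(x, y). (x\<^sup>2, y)) ` O'"
    using AB(5) by force
  ultimately show "\<exists>A B. open A \<and> open B \<and> (x\<^sup>2, y) \<in> A \<times> B \<and>
      A \<times> B \<subseteq> (\<lambda>(x, y). (x\<^sup>2, y)) ` O'"
    using AB by (intro exI[of _ "(\<lambda>x. x\<^sup>2) ` A"] exI[of _ B]) auto
qed

theorem quotient_map_quot_proj:
  "quotient_map (curve_topology (sym_poly n E)) (curve_topology (quot_poly n E)) quot_proj"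
proof -
  define f g where "f = sym_poly n E" and "g = quot_poly n E"
  define m where "m = (\<lambda>(x :: complex, y :: complex). (x\<^sup>2, y))"
  have m_cont: "continuous_on A m" for A
    unfolding m_def case_prod_unfold by (intro continuous_intros)
  have mem: "x \<in> affine_curve f \<longleftrightarrow> m x \<in> affine_curve g"
    "x \<in> affine_curve (reflect_poly f) \<longleftrightarrow> m x \<in> affine_curve (reflect_poly g)" for x
    by (auto simp: affine_curve_def m_def f_def g_def poly_sym_poly poly_reflect_sym_poly
        split: prod.splits)
  have half_degree: "degree f div 2 = 2 * (n + 1)" "degree g div 2 = n + 1"
    unfolding f_def g_def degree_sym_poly degree_quot_poly by simp_all
  have patch: "quot_proj (affine_patch x) = affine_patch (m x)"
    "quot_proj (infinity_patch f x) = infinity_patch g (m x)" for x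
    by (cases x; simp only: m_def infinity_patch.simps half_degree power_mult; simp add: power_divide)+
  have cont_gen: "openin (top_of_set A) {x \<in> A. P (m x)}"
    if "openin (top_of_set B) {y \<in> B. P y}" "\<And>x. x \<in> A \<longleftrightarrow> m x \<in> B" for A B P
  proof -
    have "{x \<in> A. P (m x)} = A \<inter> m -` {y \<in> B. P y}" using that(2) by auto
    then show ?thesis
      using continuous_openin_preimage[OF m_cont[of A] _ that(1)] that(2) by auto
  qed
  have open_gen: "openin (top_of_set B) (m ` K)"
    if K: "openin (top_of_set A) K" and m: "\<And>x. x \<in> A \<longleftrightarrow> m x \<in> B" for A B K
  proof -
    obtain O' where O': "open O'" "K = A \<inter> O'"
      using K unfolding openin_open by blast
    have "m ` K = B \<inter> m ` O'" unfolding O'(2) using m by blast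
    moreover have "open (m ` O')" using open_square_image[OF O'(1)] by (simp only: m_def)
    ultimately show ?thesis unfolding openin_open by blast
  qed
  have "continuous_map (curve_topology f) (curve_topology g) quot_proj"
    unfolding continuous_map_def
  proof (intro conjI allI impI)
    show "quot_proj \<in> topspace (curve_topology f) \<rightarrow> topspace (curve_topology g)"
      by (auto simp: f_def g_def curve_points_sym_iff)
  next
    fix S assume S: "openin (curve_topology g) S"
    let ?S = "{x \<in> topspace (curve_topology f). quot_proj x \<in> S}"
    have "{x \<in> affine_curve f. affine_patch x \<in> ?S} = {x \<in> affine_curve f. affine_patch (m x) \<in> S}"
      unfolding patch(1)[symmetric] topspace_curve_topology curve_points_def by blast
    moreover have "{x \<in> affine_curve (reflect_poly f). infinity_patch f x \<in> ?S}
        = {x \<in> affine_curve (reflect_poly f). infinity_patch g (m x) \<in> S}"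
      unfolding patch(2)[symmetric] topspace_curve_topology curve_points_def by blast
    moreover have "openin (top_of_set (affine_curve f)) {x \<in> affine_curve f. affine_patch (m x) \<in> S}"
      using S by (intro cont_gen[OF _ mem(1)]) (simp only: openin_curve_topology)
    moreover have "openin (top_of_set (affine_curve (reflect_poly f)))
        {x \<in> affine_curve (reflect_poly f). infinity_patch g (m x) \<in> S}"
      using S by (intro cont_gen[OF _ mem(2)]) (simp only: openin_curve_topology)
    ultimately show "openin (curve_topology f) ?S"
      by (simp only: openin_curve_topology) simp
  qed
  moreover have "open_map (curve_topology f) (curve_topology g) quot_proj"
    unfolding open_map_def
  proof (intro allI impI)
    fix S assume S: "openin (curve_topology f) S"
    have sub: "S \<subseteq> curve_points f" using S by (simp add: openin_curve_topology)
    have inj_inf: "infinity_patch h x = infinity_patch h y \<longleftrightarrow> x = y" for h x y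
      by (cases x; cases y) auto
    have "{y \<in> affine_curve g. affine_patch y \<in> quot_proj ` S}
        = m ` {x \<in> affine_curve f. affine_patch x \<in> S}" (is "?L = ?R")
    proof
      show "?R \<subseteq> ?L"
      proof
        fix y assume "y \<in> ?R"
        then obtain x where x: "x \<in> affine_curve f" "affine_patch x \<in> S" "y = m x" by blast
        show "y \<in> ?L"
          unfolding x(3) mem_Collect_eq patch(1)[symmetric] using x mem(1)[of x] by blast
      qed
      show "?L \<subseteq> ?R"
      proof
        fix y assume y: "y \<in> ?L"
        then obtain p where p: "p \<in> S" "affine_patch y = quot_proj p" by auto
        obtain z w where zw: "p = Affine z w" using p(2) by (cases p; cases y) auto
        then have "m (z, w) = y" using p(2) by (cases y) (auto simp: m_def)
        then show "y \<in> ?R" using y p zw mem(1)[of "(z, w)"] by (auto intro!: image_eqI[of _ _ "(z, w)"])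
      qed
    qed
    moreover have "{y \<in> affine_curve (reflect_poly g). infinity_patch g y \<in> quot_proj ` S}
        = m ` {x \<in> affine_curve (reflect_poly f). infinity_patch f x \<in> S}" (is "?L = ?R")
    proof
      show "?R \<subseteq> ?L"
      proof
        fix y assume "y \<in> ?R"
        then obtain x where x: "x \<in> affine_curve (reflect_poly f)" "infinity_patch f x \<in> S" "y = m x" by blast
        show "y \<in> ?L"
          unfolding x(3) mem_Collect_eq patch(2)[symmetric] using x mem(2)[of x] by blast
      qed
      show "?L \<subseteq> ?R"
      proof
        fix y assume y: "y \<in> ?L"
        then obtain p where p: "p \<in> S" "infinity_patch g y = quot_proj p" by auto
        obtain x where x: "infinity_patch f x = p"
        proof (cases p)
          case (Affine z w)
          then have "z \<noteq> 0" using p(2) by (cases y) (auto split: if_splits)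
          then show ?thesis
            using that[of "(1 / z, w / z ^ (degree f div 2))"] Affine by (simp add: power_divide)
        next
          case (Infinity v)
          then show ?thesis using that[of "(0, v)"] by simp
        qed
        then have "m x = y" using p(2) patch(2)[of x] inj_inf by metis
        then show "y \<in> ?R" using y p x mem(2)[of x] by auto
      qed
    qed
    moreover have "quot_proj ` S \<subseteq> curve_points g"
      using sub by (auto simp: f_def g_def curve_points_sym_iff)
    ultimately show "openin (curve_topology g) (quot_proj ` S)"
      using S open_gen[OF _ mem(1)] open_gen[OF _ mem(2)] by (simp add: openin_curve_topology)
  qed
  ultimately show ?thesis
    using continuous_open_imp_quotient_map[of "curve_topology f" "curve_topology g" quot_proj]
      quot_proj_surj[of n E] by (simp add: f_def g_def)
qed

end

theory Submission
  imports Defs "HOL-Computational_Algebra.Fundamental_Theorem_Algebra"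
begin

text \<open>Let \<open>f\<close> be squarefree of degree \<open>2k \<ge> 4\<close>.  The holomorphic differentials on \<open>w\<^sup>2 = f(z)\<close> are
  exactly the \<open>P(z) dz/w\<close> with \<open>deg P \<le> k - 2\<close>.  Indeed, divide a holomorphic differential by
  \<open>dz/w\<close>: the quotient \<open>r(z, w)\<close> is continuous on the affine curve, holomorphic in \<open>z\<close> off the branch
  points and \<open>O(z^(k-2))\<close> at infinity.  Hence \<open>(r(z, w) - r(z, -w))\<^sup>2\<close> is a polynomial in \<open>z\<close> of degree at
  most \<open>2k - 4\<close> that vanishes at the \<open>2k\<close> roots of \<open>f\<close>, so it is zero, and
  \<open>r(z, w) + r(z, -w)\<close> is a polynomial of degree at most \<open>k - 2\<close>.

  In these terms the pullback along \<open>\<lambda> = z\<^sup>2\<close> sends \<open>P(\<lambda>) d\<lambda>/w\<close> to \<open>2 z P(z\<^sup>2) dz/w\<close>, and a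
  differential \<open>R(z) dz/w\<close> is invariant under \<open>z \<mapsto> -z\<close> iff \<open>R\<close> is odd.\<close>

section \<open>Topology and local parametrisations of the curve\<close>

text \<open>Over the \<open>z\<close>-plane \<open>r(z, w)\<close> is two-valued, and no square root
  of \<open>f\<close> is continuous on the whole plane. One-variable analysis therefore only reaches
  expressions symmetric in the two values. The difference \<open>r(z, w) - r(z, -w)\<close> changes
  sign when the roots are swapped, which is why it is squared. At a branch point \<open>z\<close> is
  not a local coordinate, so \<open>r\<close> is only known to be continuous in \<open>z\<close>
  there; removability of isolated singularities closes this gap. The exponent \<open>k - 2\<close>
  is the vanishing order of \<open>dz/w\<close> at each point at infinity.

  A differential is a family of coefficients over all admissible charts, each with its own inverse
  \<open>inv_into U\<close>. To avoid one computation per pair of charts, derivatives are taken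
  along an analytic arc \<open>t -> (a t, b t)\<close> that inverts a chart near the given point:
  the coefficient of \<open>P(z) dz/w\<close> times the derivative of the coordinate along the arc
  does not depend on the coordinate.\<close>

text \<open>The kind of a chart is recognised by comparing its coordinate map with these three
  functions. The point \<open>Affine 2 0\<close> separates them: the values are 2, 0 and
  1/2.\<close>

lemma coords_distinct [simp]:
  "z_coord \<noteq> w_coord" "w_coord \<noteq> z_coord" "z_coord \<noteq> u_coord"
  "u_coord \<noteq> z_coord" "w_coord \<noteq> u_coord" "u_coord \<noteq> w_coord"
proof -
  have "z_coord (Affine 2 0) \<noteq> w_coord (Affine 2 0)" "z_coord (Affine 2 0) \<noteq> u_coord (Affine 2 0)"
    "w_coord (Affine 2 0) \<noteq> u_coord (Affine 2 0)" by simp_all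
  then show "z_coord \<noteq> w_coord" "w_coord \<noteq> z_coord" "z_coord \<noteq> u_coord"
    "u_coord \<noteq> z_coord" "w_coord \<noteq> u_coord" "u_coord \<noteq> w_coord" by metis+
qed

lemma curve_atlas_cases [consumes 2, case_names z w u infinity]:
  assumes "(U, \<phi>) \<in> curve_atlas f" and "p \<in> U"
  obtains z w where "\<phi> = z_coord" "p = Affine z w" "w \<noteq> 0"
    | z w where "\<phi> = w_coord" "p = Affine z w" "poly (pderiv f) z \<noteq> 0"
    | z w where "\<phi> = u_coord" "p = Affine z w" "z \<noteq> 0" "w \<noteq> 0"
    | v where "\<phi> = u_coord" "p = Infinity v"
  using assms unfolding curve_atlas_def by blast

lemma curve_atlas_openin: "(U, \<phi>) \<in> curve_atlas f \<Longrightarrow> openin (curve_topology f) U"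
  and curve_atlas_inj_on: "(U, \<phi>) \<in> curve_atlas f \<Longrightarrow> inj_on \<phi> U"
  by (auto simp: curve_atlas_def)

lemma curve_atlas_subset: "(U, \<phi>) \<in> curve_atlas f \<Longrightarrow> U \<subseteq> curve_points f"
  using curve_atlas_openin openin_curve_topology by blast

text \<open>This turns openness in the glued topology into a statement about convergent families on
  an affine model, which is what the arcs through a point need.\<close>

lemma openin_eventually_mem:
  fixes a b :: "'a \<Rightarrow> complex"
  assumes "openin (top_of_set S) T" "(x, y) \<in> T" "(a \<longlongrightarrow> x) F" "(b \<longlongrightarrow> y) F"
    and "\<forall>\<^sub>F t in F. (a t, b t) \<in> S"
  shows "\<forall>\<^sub>F t in F. (a t, b t) \<in> T"
proof -
  obtain O' where O': "open O'" "T = S \<inter> O'" using assms(1) by (auto simp: openin_open)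
  have "((\<lambda>t. (a t, b t)) \<longlongrightarrow> (x, y)) F" by (intro tendsto_intros assms)
  then have "\<forall>\<^sub>F t in F. (a t, b t) \<in> O'"
    using O' assms(2) by (auto dest: topological_tendstoD)
  then show ?thesis using assms(5) by eventually_elim (simp add: O')
qed

lemma eventually_Affine_mem:
  assumes "openin (curve_topology f) U" "Affine z w \<in> U" "even (degree f)"
    and "(a \<longlongrightarrow> z) F" "(b \<longlongrightarrow> w) F" "\<forall>\<^sub>F t in F. (b t)\<^sup>2 = poly f (a t)"
  shows "\<forall>\<^sub>F t in F. Affine (a t) (b t) \<in> U"
proof -
  have eq: "w\<^sup>2 = poly f z"
    using assms(2,3) affine_mem_curve_points openin_subset[OF assms(1)] by auto
  have "openin (top_of_set (affine_curve f)) {x \<in> affine_curve f. affine_patch x \<in> U}"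
    using assms(1) by (simp only: openin_curve_topology)
  then have "\<forall>\<^sub>F t in F. (a t, b t) \<in> {x \<in> affine_curve f. affine_patch x \<in> U}"
    by (rule openin_eventually_mem) (use assms(2,4-6) eq in \<open>simp_all add: affine_curve_def\<close>)
  then show ?thesis by (rule eventually_mono) simp
qed

lemma eventually_infinity_patch_mem:
  assumes "openin (curve_topology f) U" "infinity_patch f (u, v) \<in> U" "v\<^sup>2 = poly (reflect_poly f) u"
    and "(a \<longlongrightarrow> u) F" "(b \<longlongrightarrow> v) F" "\<forall>\<^sub>F t in F. (b t)\<^sup>2 = poly (reflect_poly f) (a t)"
  shows "\<forall>\<^sub>F t in F. infinity_patch f (a t, b t) \<in> U"
proof -
  have "openin (top_of_set (affine_curve (reflect_poly f)))
      {x \<in> affine_curve (reflect_poly f). infinity_patch f x \<in> U}"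
    using assms(1) by (simp only: openin_curve_topology)
  then have "\<forall>\<^sub>F t in F. (a t, b t) \<in> {x \<in> affine_curve (reflect_poly f). infinity_patch f x \<in> U}"
    by (rule openin_eventually_mem)
      (use assms(2-6) in \<open>simp_all add: affine_curve_def del: infinity_patch.simps\<close>)
  then show ?thesis by eventually_elim auto
qed

text \<open>The patch is injective, so its own preimage of the image is \<open>W\<close>. The
  preimage under the other patch is the preimage of \<open>W\<close> under the transition map
  \<open>h\<close>, which is continuous on the relatively open set
  \<open>u \<noteq> 0\<close>.\<close>

lemma openin_affine_patch_image:
  assumes "openin (top_of_set (affine_curve f)) W" "even (degree f)"
  shows "openin (curve_topology f) (affine_patch ` W)"
  unfolding openin_curve_topology
proof (intro conjI)
  have W: "W \<subseteq> affine_curve f" using assms(1) openin_imp_subset by blast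
  then show "affine_patch ` W \<subseteq> curve_points f" by (auto simp: curve_points_def)
  have "{x \<in> affine_curve f. affine_patch x \<in> affine_patch ` W} = W"
    using W by auto
  then show "openin (top_of_set (affine_curve f)) {x \<in> affine_curve f. affine_patch x \<in> affine_patch ` W}"
    using assms by simp
  define h where "h = (\<lambda>(u :: complex, v :: complex). (1 / u, v / u ^ (degree f div 2)))"
  define S where "S = affine_curve (reflect_poly f) - {0} \<times> UNIV"
  have h: "h x \<in> affine_curve f" if "x \<in> S" for x
  proof -
    obtain u v where x: "x = (u, v)" by (cases x)
    have "u \<noteq> 0" "(u, v) \<in> affine_curve (reflect_poly f)"
      using that x by (auto simp: S_def)
    note x = x this
    have "infinity_patch f (u, v) \<in> curve_points f"
      using x(3) unfolding curve_points_def by blast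
    then show ?thesis
      using x assms(2) by (simp add: h_def affine_mem_curve_points affine_curve_def)
  qed
  have hc: "continuous_on S h"
    unfolding h_def case_prod_unfold S_def by (intro continuous_intros) auto
  have "openin (top_of_set S) (S \<inter> h -` W)"
    using continuous_openin_preimage[OF hc _ assms(1)] h by blast
  moreover have "openin (top_of_set (affine_curve (reflect_poly f))) S"
    unfolding S_def Diff_eq by (rule openin_open_Int) (intro open_Compl closed_Times; simp)
  ultimately have "openin (top_of_set (affine_curve (reflect_poly f))) (S \<inter> h -` W)"
    by (rule openin_trans)
  moreover have "{x \<in> affine_curve (reflect_poly f). infinity_patch f x \<in> affine_patch ` W} = S \<inter> h -` W"
    (is "?L = ?R")
  proof
    show "?L \<subseteq> ?R"
      by (auto simp: S_def h_def split: if_splits)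
    show "?R \<subseteq> ?L"
    proof
      fix x assume "x \<in> ?R"
      moreover obtain u v where x: "x = (u, v)" by (cases x)
      ultimately have "u \<noteq> 0" "x \<in> affine_curve (reflect_poly f)" "(1 / u, v / u ^ (degree f div 2)) \<in> W"
        by (auto simp: S_def h_def)
      then show "x \<in> ?L"
        by (auto simp: x intro!: image_eqI[of _ _ "(1 / u, v / u ^ (degree f div 2))"])
    qed
  qed
  ultimately show "openin (top_of_set (affine_curve (reflect_poly f)))
      {x \<in> affine_curve (reflect_poly f). infinity_patch f x \<in> affine_patch ` W}" by simp
qed

lemma openin_infinity_patch_image:
  assumes "openin (top_of_set (affine_curve (reflect_poly f))) W" "even (degree f)"
  shows "openin (curve_topology f) (infinity_patch f ` W)"
  unfolding openin_curve_topology
proof (intro conjI)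
  have W: "W \<subseteq> affine_curve (reflect_poly f)" using assms(1) openin_imp_subset by blast
  then show "infinity_patch f ` W \<subseteq> curve_points f" by (auto simp: curve_points_def)
  have "{x \<in> affine_curve (reflect_poly f). infinity_patch f x \<in> infinity_patch f ` W} = W"
    using W by (auto split: if_splits)
  then show "openin (top_of_set (affine_curve (reflect_poly f)))
      {x \<in> affine_curve (reflect_poly f). infinity_patch f x \<in> infinity_patch f ` W}"
    using assms by simp
  define h where "h = (\<lambda>(z :: complex, w :: complex). (1 / z, w / z ^ (degree f div 2)))"
  define S where "S = affine_curve f - {0} \<times> UNIV"
  have h: "h x \<in> affine_curve (reflect_poly f)" if "x \<in> S" for x
  proof -
    obtain z w where x: "x = (z, w)" by (cases x)
    have "z \<noteq> 0" "w\<^sup>2 = poly f z"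
      using that x by (auto simp: S_def affine_curve_def)
    then have "(w / z ^ (degree f div 2))\<^sup>2 = poly (reflect_poly f) (1 / z)"
      using assms(2) by (simp add: power_divide poly_reflect_poly_nz flip: power_mult)
    then show ?thesis by (simp add: x h_def affine_curve_def)
  qed
  have hc: "continuous_on S h"
    unfolding h_def case_prod_unfold S_def by (intro continuous_intros) auto
  have "openin (top_of_set S) (S \<inter> h -` W)"
    using continuous_openin_preimage[OF hc _ assms(1)] h by blast
  moreover have "openin (top_of_set (affine_curve f)) S"
    unfolding S_def Diff_eq by (rule openin_open_Int) (intro open_Compl closed_Times; simp)
  ultimately have "openin (top_of_set (affine_curve f)) (S \<inter> h -` W)"
    by (rule openin_trans)
  moreover have "{x \<in> affine_curve f. affine_patch x \<in> infinity_patch f ` W} = S \<inter> h -` W"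
    (is "?L = ?R")
  proof
    show "?L \<subseteq> ?R"
      by (auto simp: S_def h_def power_divide split: if_splits)
    show "?R \<subseteq> ?L"
    proof
      fix x assume "x \<in> ?R"
      moreover obtain z w where x: "x = (z, w)" by (cases x)
      ultimately have "z \<noteq> 0" "x \<in> affine_curve f" "(1 / z, w / z ^ (degree f div 2)) \<in> W"
        by (auto simp: S_def h_def)
      then show "x \<in> ?L"
        by (auto simp: x power_divide intro!: image_eqI[of _ _ "(1 / z, w / z ^ (degree f div 2))"])
    qed
  qed
  ultimately show "openin (top_of_set (affine_curve f))
      {x \<in> affine_curve f. affine_patch x \<in> infinity_patch f ` W}" by simp
qed

section \<open>Analytic square roots, local inverses and arcs in charts\<close>

lemma holomorphic_on_poly: "poly p holomorphic_on S"
  unfolding holomorphic_on_def field_differentiable_def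
  using has_field_derivative_at_within[OF poly_DERIV] by auto

lemma analytic_on_poly [analytic_intros]:
  "g analytic_on S \<Longrightarrow> (\<lambda>t. poly p (g t)) analytic_on S"
  using analytic_on_compose_gen[of g S "poly p" UNIV] holomorphic_on_poly[of p UNIV]
  by (simp add: o_def analytic_on_open)

lemma poly_analytic_sqrt:
  fixes g :: "complex poly"
  assumes "y\<^sup>2 = poly g x" "y \<noteq> 0"
  obtains s where "s analytic_on {x}" "s x = y" "\<And>t. (s t)\<^sup>2 = poly g t"
proof
  \<comment> \<open>The quotient under the root equals 1 at \<open>x\<close>, far from the cut of
    \<open>csqrt\<close>; so \<open>?s\<close> is analytic there, while its square is
    \<open>poly g t\<close> for every \<open>t\<close>.\<close>
  let ?s = "\<lambda>t. y * csqrt (poly g t / poly g x)"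
  have nz: "poly g x \<noteq> 0" using assms by (metis power_not_zero)
  show "?s analytic_on {x}"
    using nz by (intro analytic_intros) auto
  show "?s x = y" using nz by simp
  show "(?s t)\<^sup>2 = poly g t" for t
    using nz assms by (simp add: power_mult_distrib)
qed

lemma poly_analytic_local_inverse:
  fixes f :: "complex poly"
  assumes "poly (pderiv f) z \<noteq> 0"
  obtains g where "g analytic_on {poly f z}" "g (poly f z) = z"
    "\<forall>\<^sub>F t in nhds (poly f z). poly f (g t) = t"
proof -
  have "deriv (poly f) z \<noteq> 0" using assms DERIV_imp_deriv[OF poly_DERIV[of f z]] by simp
  then obtain r where r: "r > 0" "open (poly f ` ball z r)" "inj_on (poly f) (ball z r)"
    using has_complex_derivative_locally_invertible[of "poly f" UNIV z] holomorphic_on_poly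
    by (metis UNIV_I open_UNIV)
  obtain g where g: "g holomorphic_on poly f ` ball z r" "\<And>x. x \<in> ball z r \<Longrightarrow> g (poly f x) = x"
    using holomorphic_has_inverse[OF holomorphic_on_poly open_ball r(3)] by metis
  have mem: "poly f z \<in> poly f ` ball z r" using r by auto
  then have "\<forall>\<^sub>F t in nhds (poly f z). t \<in> poly f ` ball z r"
    using r(2) eventually_nhds_in_open by blast
  then have "\<forall>\<^sub>F t in nhds (poly f z). poly f (g t) = t"
    by eventually_elim (auto simp: g)
  moreover have "g analytic_on poly f ` ball z r"
    using g(1) r(2) by (simp add: analytic_on_open)
  then have "g analytic_on {poly f z}"
    by (rule analytic_on_subset) (use mem in auto)
  ultimately show ?thesis using that g r(1) by auto
qed

lemma analytic_at_tendsto: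
  "a analytic_on {t} \<Longrightarrow> (a \<longlongrightarrow> a t) (nhds t)"
  using analytic_at_imp_isCont by (force simp: isCont_def tendsto_at_iff_tendsto_nhds)

lemma inv_into_chart_eq:
  assumes "(U, \<phi>) \<in> curve_atlas f" "p \<in> U" "\<phi> p = t"
  shows "inv_into U \<phi> t = p"
  using curve_atlas_inj_on[OF assms(1)] assms(2,3) by (metis inv_into_f_f)

text \<open>The arc expresses \<open>inv_into U \<phi>\<close>, which depends on the arbitrary set
  \<open>U\<close>, by analytic functions. It treats the three kinds of charts alike, so that later
  derivative computations need no case split on the source chart.\<close>

lemma affine_chart_curve:
  assumes "even (degree f)" "(U, \<phi>) \<in> curve_atlas f" "Affine z w \<in> U" "t0 = \<phi> (Affine z w)"
  obtains a b where "a analytic_on {t0}" "b analytic_on {t0}" "a t0 = z" "b t0 = w"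
    "\<forall>\<^sub>F t in nhds t0. (b t)\<^sup>2 = poly f (a t)"
    "\<forall>\<^sub>F t in nhds t0. Affine (a t) (b t) \<in> U"
    "\<forall>\<^sub>F t in nhds t0. inv_into U \<phi> t = Affine (a t) (b t)"
    "\<forall>\<^sub>F t in nhds t0. \<phi> (Affine (a t) (b t)) = t"
proof -
  note result = that
  have eq: "w\<^sup>2 = poly f z"
    using affine_mem_curve_points[OF assms(1)] curve_atlas_subset[OF assms(2)] assms(3) by auto
  \<comment> \<open>Only the curve equation and the coordinate identity depend on the kind of chart.
    Membership in \<open>U\<close> then follows from openness, and injectivity of
    \<open>\<phi>\<close> forces the value of \<open>inv_into\<close>.\<close>
  have *: thesis
    if ab: "a analytic_on {t0}" "b analytic_on {t0}" "a t0 = z" "b t0 = w"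
      "\<forall>\<^sub>F t in nhds t0. (b t)\<^sup>2 = poly f (a t)" "\<forall>\<^sub>F t in nhds t0. \<phi> (Affine (a t) (b t)) = t" for a b
  proof -
    have U: "\<forall>\<^sub>F t in nhds t0. Affine (a t) (b t) \<in> U"
      using curve_atlas_openin[OF assms(2)] assms(3,1)
      by (rule eventually_Affine_mem)
        (use ab analytic_at_tendsto[OF ab(1)] analytic_at_tendsto[OF ab(2)] in simp_all)
    moreover have "\<forall>\<^sub>F t in nhds t0. inv_into U \<phi> t = Affine (a t) (b t)"
      using U ab(6) by eventually_elim (rule inv_into_chart_eq[OF assms(2)])
    ultimately show thesis using result[of a b] ab by blast
  qed
  show thesis
    using assms(2,3)
  proof (cases rule: curve_atlas_cases)
    case (z z' w')
    then have t0: "t0 = z" and "w \<noteq> 0" using assms(4) by auto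
    obtain s where s: "s analytic_on {z}" "s z = w" "\<And>t. (s t)\<^sup>2 = poly f t"
      using poly_analytic_sqrt[OF eq \<open>w \<noteq> 0\<close>] by metis
    show thesis
      by (rule *[of "\<lambda>t. t" s]) (use s z t0 in auto)
  next
    \<comment> \<open>Here \<open>t\<close> is the value of \<open>w\<close>, so \<open>z\<close> is
      recovered from \<open>f(z) = t^2\<close> by the local inverse \<open>g\<close> of
      \<open>f\<close>, applied to \<open>t^2\<close>.\<close>
    case (w z' w')
    then have t0: "t0 = w" and "poly (pderiv f) z \<noteq> 0" using assms(4) by auto
    then obtain g where g: "g analytic_on {poly f z}" "g (poly f z) = z"
      "\<forall>\<^sub>F t in nhds (poly f z). poly f (g t) = t"
      using poly_analytic_local_inverse[of f z] by metis
    have "((\<lambda>t. t\<^sup>2) \<longlongrightarrow> poly f z) (nhds w)"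
      unfolding eq[symmetric] by (intro tendsto_intros filterlim_ident)
    then have "\<forall>\<^sub>F t in nhds w. t\<^sup>2 = poly f (g (t\<^sup>2))"
      using eventually_compose_filterlim[OF g(3)] by (auto simp: eq_commute)
    moreover have "(\<lambda>t. t\<^sup>2) analytic_on {w}" by (intro analytic_intros)
    then have "(\<lambda>t. g (t\<^sup>2)) analytic_on {w}"
      using analytic_on_compose_gen[of "\<lambda>t. t\<^sup>2" "{w}" g "{poly f z}"] g(1) eq
      by (simp add: o_def)
    ultimately show thesis
      by (intro *[of "\<lambda>t. g (t\<^sup>2)" "\<lambda>t. t"]) (use g w t0 eq in auto)
  next
    case (u z' w')
    then have t0: "t0 = 1 / z" and nz: "z \<noteq> 0" "w \<noteq> 0" using assms(4) by auto
    obtain s where s: "s analytic_on {z}" "s z = w" "\<And>t. (s t)\<^sup>2 = poly f t"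
      using poly_analytic_sqrt[OF eq nz(2)] by metis
    have inv: "(\<lambda>t. 1 / t) analytic_on {t0}"
      using nz by (intro analytic_intros) (auto simp: t0)
    have "(\<lambda>t. s (1 / t)) analytic_on {t0}"
      using analytic_on_compose_gen[OF inv, of s "{z}"] s(1) by (simp add: o_def t0)
    then show thesis
      using inv by (intro *[of "\<lambda>t. 1 / t" "\<lambda>t. s (1 / t)"]) (use s u t0 in auto)
  next
    case (infinity v)
    then show thesis by simp
  qed
qed

lemma u_coord_infinity_patch [simp]: "u_coord (infinity_patch f (u, v)) = u"
  by simp

lemma reflect_poly_sqrt_at_0:
  fixes f :: "complex poly"
  assumes "v0\<^sup>2 = lead_coeff f" "f \<noteq> 0"
  obtains v where "v analytic_on {0}" "v 0 = v0" "\<And>t. (v t)\<^sup>2 = poly (reflect_poly f) t"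
proof -
  have "v0\<^sup>2 = poly (reflect_poly f) 0" "v0 \<noteq> 0"
    using assms by (auto simp: poly_0_coeff_0)
  then show thesis using poly_analytic_sqrt that by metis
qed

lemma eventually_infinity_chart:
  assumes "(U, u_coord) \<in> curve_atlas f" "Infinity (v 0) \<in> U"
    "v analytic_on {0}" "\<And>t. (v t)\<^sup>2 = poly (reflect_poly f) t"
  shows "\<forall>\<^sub>F t in nhds 0. infinity_patch f (t, v t) \<in> U \<and> inv_into U u_coord t = infinity_patch f (t, v t)"
proof -
  have "\<forall>\<^sub>F t in nhds 0. infinity_patch f (t, v t) \<in> U"
    by (rule eventually_infinity_patch_mem[OF curve_atlas_openin[OF assms(1)], of 0 "v 0"])
      (use assms(2,4) analytic_at_tendsto[OF assms(3)] in \<open>auto simp: filterlim_ident\<close>)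
  then show ?thesis
    by eventually_elim (use inv_into_chart_eq[OF assms(1)] u_coord_infinity_patch in blast)
qed

section \<open>Charts around ordinary points, branch points and points at infinity\<close>

lemma z_chart_exists:
  assumes "even (degree f)" "w\<^sup>2 = poly f z" "w \<noteq> 0"
  obtains U where "(U, z_coord) \<in> curve_atlas f" "Affine z w \<in> U"
proof
  \<comment> \<open>The half-plane \<open>Re (y / w) > 0\<close> contains at most one of
    \<open>y\<close> and \<open>- y\<close>, so \<open>z\<close> is injective on \<open>W\<close>;
    it also excludes \<open>y = 0\<close>.\<close>
  define W where "W = affine_curve f \<inter> {(x, y). Re (y / w) > 0}"
  have "openin (top_of_set (affine_curve f)) W"
    unfolding W_def case_prod_unfold by (intro openin_open_Int open_Collect_less continuous_intros)
      (simp add: assms(3))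
  then have "openin (curve_topology f) (affine_patch ` W)"
    using assms(1) openin_affine_patch_image by blast
  moreover have "inj_on z_coord (affine_patch ` W)"
  proof (clarsimp simp: inj_on_def W_def affine_curve_def)
    fix x y y' assume "0 < Re (y / w)" "0 < Re (y' / w)" "y\<^sup>2 = poly f x" "y'\<^sup>2 = poly f x"
    then show "y = y'" using power2_eq_iff[of y y'] by auto
  qed
  ultimately show "(affine_patch ` W, z_coord) \<in> curve_atlas f"
    by (auto simp: curve_atlas_def W_def)
  show "Affine z w \<in> affine_patch ` W"
    using assms by (auto simp: W_def affine_curve_def intro!: image_eqI[of _ _ "(z, w)"])
qed

lemma w_chart_exists:
  assumes "even (degree f)" "w\<^sup>2 = poly f z" "poly (pderiv f) z \<noteq> 0"
  obtains U where "(U, w_coord) \<in> curve_atlas f" "Affine z w \<in> U"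
proof -
  have "deriv (poly f) z \<noteq> 0" using assms DERIV_imp_deriv[OF poly_DERIV[of f z]] by simp
  then obtain r where r: "r > 0" "inj_on (poly f) (ball z r)"
    using has_complex_derivative_locally_injective[OF holomorphic_on_poly, of z UNIV f] by auto
  \<comment> \<open>On the ball \<open>f\<close> is injective, so \<open>w\<close> determines
    \<open>w^2 = f(z)\<close> and hence \<open>z\<close>. The second factor keeps \<open>f'\<close>
    nonzero, as a \<open>w\<close>-chart demands.\<close>
  define B where "B = ball z r \<inter> {x. poly (pderiv f) x \<noteq> 0}"
  define W where "W = affine_curve f \<inter> B \<times> UNIV"
  have "open B" unfolding B_def
    by (intro open_Int open_ball open_Collect_neq continuous_intros)
  then have "openin (top_of_set (affine_curve f)) W"
    unfolding W_def by (intro openin_open_Int open_Times) auto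
  then have "openin (curve_topology f) (affine_patch ` W)"
    using assms(1) openin_affine_patch_image by blast
  moreover have "inj_on w_coord (affine_patch ` W)"
    using r(2) by (auto simp: inj_on_def W_def B_def affine_curve_def)
  ultimately have "(affine_patch ` W, w_coord) \<in> curve_atlas f"
    by (auto simp: curve_atlas_def W_def B_def)
  moreover have "Affine z w \<in> affine_patch ` W"
    using assms r by (auto simp: W_def B_def affine_curve_def intro!: image_eqI[of _ _ "(z, w)"])
  ultimately show thesis using that by blast
qed

lemma infinity_chart_exists:
  assumes "even (degree f)" "v\<^sup>2 = lead_coeff f" "f \<noteq> 0"
  obtains U where "(U, u_coord) \<in> curve_atlas f" "Infinity v \<in> U"
proof
  have "v \<noteq> 0" using assms by auto
  define W where "W = affine_curve (reflect_poly f) \<inter> {(x, y). Re (y / v) > 0}"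
  have "openin (top_of_set (affine_curve (reflect_poly f))) W"
    unfolding W_def case_prod_unfold by (intro openin_open_Int open_Collect_less continuous_intros)
      (simp add: \<open>v \<noteq> 0\<close>)
  then have "openin (curve_topology f) (infinity_patch f ` W)"
    using assms(1) openin_infinity_patch_image by blast
  moreover have "inj_on u_coord (infinity_patch f ` W)"
  proof (rule inj_onI)
    fix p q assume "p \<in> infinity_patch f ` W" "q \<in> infinity_patch f ` W" "u_coord p = u_coord q"
    then obtain x y x' y' where *: "p = infinity_patch f (x, y)" "q = infinity_patch f (x', y')"
      "(x, y) \<in> W" "(x', y') \<in> W" by (metis imageE surj_pair)
    then have "x' = x" using \<open>u_coord p = u_coord q\<close> u_coord_infinity_patch by metis
    note * = *[unfolded this]
    then have "y = y'" using power2_eq_iff[of y y'] by (auto simp: W_def affine_curve_def)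
    then show "p = q" using * by simp
  qed
  moreover have "infinity_patch f ` W \<subseteq> range Infinity \<union> {Affine z w | z w. z \<noteq> 0 \<and> w \<noteq> 0}"
    by (auto simp: W_def split: if_splits)
  ultimately show "(infinity_patch f ` W, u_coord) \<in> curve_atlas f"
    unfolding curve_atlas_def by blast
  show "Infinity v \<in> infinity_patch f ` W"
    using assms \<open>v \<noteq> 0\<close>
    by (auto simp: W_def affine_curve_def poly_0_coeff_0 intro!: image_eqI[of _ _ "(0, v)"])
qed

section \<open>Polynomial differentials\<close>

text \<open>The coefficients of \<open>P(z) dz/w\<close>, where \<open>dz/w = 2 dw/f'(z) = - z\<^sup>2 du/w\<close>.  At infinity
  \<open>z\<^sup>2 P(z)/w = u^(k-2) P(1/u)/v\<close> has the value \<open>coeff P (k-2)/v\<close>, provided that \<open>deg P \<le> k - 2\<close>.\<close>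

fun differential_coeff ::
    "complex poly \<Rightarrow> complex poly \<Rightarrow> (curve_point \<Rightarrow> complex) \<Rightarrow> curve_point \<Rightarrow> complex" where
  "differential_coeff f P \<phi> (Affine z w) =
     (if \<phi> = z_coord then poly P z / w
      else if \<phi> = w_coord then 2 * poly P z / poly (pderiv f) z
      else - (z\<^sup>2 * poly P z / w))"
| "differential_coeff f P \<phi> (Infinity v) = - (coeff P (degree f div 2 - 2) / v)"

definition poly_differential :: "complex poly \<Rightarrow> complex poly \<Rightarrow> curve_point differential" where
  "poly_differential f P = (\<lambda>(U, \<phi>) p.
     if (U, \<phi>) \<in> curve_atlas f \<and> p \<in> U then differential_coeff f P \<phi> p else 0)"

lemma poly_differential_eq:
  "(U, \<phi>) \<in> curve_atlas f \<Longrightarrow> p \<in> U \<Longrightarrow> poly_differential f P (U, \<phi>) p = differential_coeff f P \<phi> p"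
  by (simp add: poly_differential_def)

text \<open>The right-hand side is the pullback of \<open>P(z) dz/w\<close> to the arc and does not
  mention \<open>\<psi>\<close>: this is chart independence. Differentiating the curve equation
  gives \<open>2 w w' = f'(z) z'\<close>, which exchanges \<open>dz/w\<close> for
  \<open>2 dw/f'(z)\<close>. The latter form is needed at \<open>w = 0\<close>, where only
  \<open>w\<close>-charts are available.\<close>

lemma differential_coeff_along_curve:
  assumes "(V, \<psi>) \<in> curve_atlas f" "Affine (a t0) (b t0) \<in> V"
    and a: "(a has_field_derivative a') (at t0)" and b: "(b has_field_derivative b') (at t0)"
    and eq: "\<forall>\<^sub>F t in nhds t0. (b t)\<^sup>2 = poly f (a t)"
  shows "differential_coeff f P \<psi> (Affine (a t0) (b t0)) * deriv (\<lambda>t. \<psi> (Affine (a t) (b t))) t0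
    = (if b t0 \<noteq> 0 then poly P (a t0) * a' / b t0 else 2 * poly P (a t0) * b' / poly (pderiv f) (a t0))"
proof -
  have "((\<lambda>t. (b t)\<^sup>2) has_field_derivative 2 * b t0 * b') (at t0)"
    by (rule derivative_eq_intros b refl)+ simp
  moreover have "((\<lambda>t. poly f (a t)) has_field_derivative poly (pderiv f) (a t0) * a') (at t0)"
    using DERIV_chain2[OF poly_DERIV a] by simp
  then have "((\<lambda>t. (b t)\<^sup>2) has_field_derivative poly (pderiv f) (a t0) * a') (at t0)"
    using DERIV_cong_ev[OF refl eq refl] by blast
  ultimately have rel: "2 * b t0 * b' = poly (pderiv f) (a t0) * a'"
    by (rule DERIV_unique)
  show ?thesis
    using assms(1,2)
  proof (cases rule: curve_atlas_cases)
    case (z z' w')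
    then show ?thesis using DERIV_imp_deriv[OF a] by simp
  next
    case (w z' w')
    then show ?thesis using DERIV_imp_deriv[OF b] rel
      by (auto simp: field_simps)
  next
    case (u z' w')
    then have nz: "a t0 \<noteq> 0" "b t0 \<noteq> 0" by simp_all
    then have "((\<lambda>t. 1 / a t) has_field_derivative - a' / (a t0)\<^sup>2) (at t0)"
      using DERIV_inverse_fun[OF a nz(1)] by (simp add: divide_inverse power2_eq_square mult_ac)
    then have "deriv (\<lambda>t. 1 / a t) t0 = - a' / (a t0)\<^sup>2"
      by (rule DERIV_imp_deriv)
    then show ?thesis using u nz by simp
  next
    case (infinity v)
    then show ?thesis by simp
  qed
qed

lemma analytic_at_has_field_derivative:
  "g analytic_on {t} \<Longrightarrow> (g has_field_derivative deriv g t) (at t)"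
  by (simp add: DERIV_deriv_iff_field_differentiable analytic_on_imp_differentiable_at)

text \<open>At an affine point both sides are the same pullback to the arc that inverts
  \<open>\<phi>\<close>, and the derivative of \<open>\<phi>\<close> along this arc is 1.\<close>

lemma differential_coeff_transition:
  assumes "f \<noteq> 0" "even (degree f)" "(U, \<phi>) \<in> curve_atlas f" "(V, \<psi>) \<in> curve_atlas f" "p \<in> U" "p \<in> V"
  shows "differential_coeff f P \<phi> p =
    differential_coeff f P \<psi> p * deriv (\<psi> \<circ> inv_into U \<phi>) (\<phi> p)"
proof (cases p)
  case (Affine z w)
  have mem: "Affine z w \<in> U" "\<phi> p = \<phi> (Affine z w)" using assms(5) Affine by simp_all
  obtain a b where ab: "a analytic_on {\<phi> p}" "b analytic_on {\<phi> p}" "a (\<phi> p) = z" "b (\<phi> p) = w"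
    "\<forall>\<^sub>F t in nhds (\<phi> p). (b t)\<^sup>2 = poly f (a t)"
    "\<forall>\<^sub>F t in nhds (\<phi> p). Affine (a t) (b t) \<in> U"
    "\<forall>\<^sub>F t in nhds (\<phi> p). inv_into U \<phi> t = Affine (a t) (b t)"
    "\<forall>\<^sub>F t in nhds (\<phi> p). \<phi> (Affine (a t) (b t)) = t"
    by (rule affine_chart_curve[OF assms(2,3) mem])
  note der = analytic_at_has_field_derivative[OF ab(1)] analytic_at_has_field_derivative[OF ab(2)]
  note along = differential_coeff_along_curve[of _ _ f a "\<phi> p" b, OF _ _ der ab(5), unfolded ab(3,4)]
  have "deriv (\<lambda>t. \<phi> (Affine (a t) (b t))) (\<phi> p) = deriv (\<lambda>t. t) (\<phi> p)"
    by (rule deriv_cong_ev[OF ab(8) refl])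
  moreover have "deriv (\<psi> \<circ> inv_into U \<phi>) (\<phi> p) = deriv (\<lambda>t. \<psi> (Affine (a t) (b t))) (\<phi> p)"
    by (rule deriv_cong_ev[OF eventually_mono[OF ab(7)] refl]) simp
  ultimately show ?thesis
    using along[OF assms(3)] along[OF assms(4)] assms(5,6) Affine by simp
next
  case (Infinity v)
  have "\<phi> = u_coord" using assms(3,5) by (cases rule: curve_atlas_cases) (auto simp: Infinity)
  moreover have "\<psi> = u_coord" using assms(4,6) by (cases rule: curve_atlas_cases) (auto simp: Infinity)
  moreover have "v\<^sup>2 = lead_coeff f"
    using assms(3,5) curve_atlas_subset Infinity infinity_mem_curve_points by blast
  \<comment> \<open>Both coordinates are \<open>u_coord\<close>, but the derivative needs
    \<open>inv_into U\<close> to invert it on a whole neighbourhood of 0. The analytic root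
    \<open>s\<close> supplies the nearby points of \<open>U\<close>.\<close>
  moreover have "deriv (\<psi> \<circ> inv_into U \<phi>) (\<phi> p) = 1"
  proof -
    obtain s where s: "s analytic_on {0}" "s 0 = v" "\<And>t. (s t)\<^sup>2 = poly (reflect_poly f) t"
      using reflect_poly_sqrt_at_0 \<open>v\<^sup>2 = lead_coeff f\<close> assms(1) by metis
    have "\<forall>\<^sub>F t in nhds 0. infinity_patch f (t, s t) \<in> U \<and> inv_into U u_coord t = infinity_patch f (t, s t)"
      by (rule eventually_infinity_chart) (use assms s Infinity \<open>\<phi> = u_coord\<close> in auto)
    then have "\<forall>\<^sub>F t in nhds 0. (u_coord \<circ> inv_into U u_coord) t = t"
      by eventually_elim (simp del: infinity_patch.simps)
    then have "deriv (u_coord \<circ> inv_into U u_coord) 0 = deriv (\<lambda>t. t) 0"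
      by (rule deriv_cong_ev) simp
    then show ?thesis using \<open>\<phi> = u_coord\<close> \<open>\<psi> = u_coord\<close> Infinity by simp
  qed
  ultimately show ?thesis by simp
qed

lemma differential_coeff_analytic:
  assumes "f \<noteq> 0" "even (degree f)" "degree P + 2 \<le> degree f div 2" "(U, \<phi>) \<in> curve_atlas f" "p \<in> U"
  shows "(differential_coeff f P \<phi> \<circ> inv_into U \<phi>) analytic_on {\<phi> p}"
proof (cases p)
  case (Affine z w)
  have mem: "Affine z w \<in> U" "\<phi> p = \<phi> (Affine z w)" using assms(5) Affine by simp_all
  obtain a b where ab: "a analytic_on {\<phi> p}" "b analytic_on {\<phi> p}" "a (\<phi> p) = z" "b (\<phi> p) = w"
    "\<forall>\<^sub>F t in nhds (\<phi> p). (b t)\<^sup>2 = poly f (a t)"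
    "\<forall>\<^sub>F t in nhds (\<phi> p). Affine (a t) (b t) \<in> U"
    "\<forall>\<^sub>F t in nhds (\<phi> p). inv_into U \<phi> t = Affine (a t) (b t)"
    "\<forall>\<^sub>F t in nhds (\<phi> p). \<phi> (Affine (a t) (b t)) = t"
    by (rule affine_chart_curve[OF assms(2,4) mem])
  have "(\<lambda>t. differential_coeff f P \<phi> (Affine (a t) (b t))) analytic_on {\<phi> p}"
    using assms(4,5)
  proof (cases rule: curve_atlas_cases)
    case (z z' w')
    with ab Affine show ?thesis by (simp, intro analytic_intros) auto
  next
    case (w z' w')
    with ab Affine show ?thesis by (simp, intro analytic_intros) auto
  next
    case (u z' w')
    with ab Affine show ?thesis by (simp, intro analytic_intros) auto
  next
    case (infinity v)
    then show ?thesis using Affine by simp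
  qed
  moreover have cong: "\<forall>\<^sub>F t in nhds (\<phi> p). (differential_coeff f P \<phi> \<circ> inv_into U \<phi>) t
      = differential_coeff f P \<phi> (Affine (a t) (b t))"
    using ab(7) by eventually_elim simp
  ultimately show ?thesis using analytic_at_cong[OF cong refl] by blast
next
  case (Infinity v)
  define k where "k = degree f div 2"
  have \<phi>: "\<phi> = u_coord" using assms(4,5) by (cases rule: curve_atlas_cases) (auto simp: Infinity)
  have v: "v\<^sup>2 = lead_coeff f"
    using assms(4,5) curve_atlas_subset Infinity infinity_mem_curve_points by blast
  then obtain s where s: "s analytic_on {0}" "s 0 = v" "\<And>t. (s t)\<^sup>2 = poly (reflect_poly f) t"
    using reflect_poly_sqrt_at_0 assms(1) by metis
  have "v \<noteq> 0" using v assms(1) by auto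
  \<comment> \<open>This is \<open>t^(k-2) P(1/t)\<close>, a polynomial because
    \<open>deg P \<le> k - 2\<close>. Its value at 0 is \<open>coeff P (k - 2)\<close>, the
    coefficient prescribed at infinity, which is 0 if the degree of \<open>P\<close> is
    smaller.\<close>
  define Q where "Q = reflect_poly P * monom 1 (k - 2 - degree P)"
  have Q: "differential_coeff f P u_coord (infinity_patch f (t, y)) = - (poly Q t / y)" for t y
  proof (cases "t = 0")
    case True
    have "poly Q 0 = lead_coeff P * 0 ^ (k - 2 - degree P)"
      unfolding Q_def poly_mult poly_monom by (simp add: poly_0_coeff_0)
    then have "coeff P (k - 2) = poly Q 0"
      using assms(3) coeff_eq_0[of P "k - 2"] unfolding k_def[symmetric]
      by (cases "degree P = k - 2") (auto simp: power_0_left)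
    then show ?thesis using True by (simp add: k_def)
  next
    case False
    have "k = degree P + (k - 2 - degree P) + 2" using assms(3) by (simp add: k_def)
    then have "t ^ k = t ^ degree P * t ^ (k - 2 - degree P) * t\<^sup>2"
      by (metis power_add)
    then show ?thesis using False
      by (simp add: Q_def poly_monom poly_reflect_poly_nz field_simps inverse_eq_divide
          k_def[symmetric])
  qed
  have "\<forall>\<^sub>F t in nhds 0. infinity_patch f (t, s t) \<in> U \<and> inv_into U u_coord t = infinity_patch f (t, s t)"
    by (rule eventually_infinity_chart) (use assms s Infinity \<phi> in auto)
  then have cong: "\<forall>\<^sub>F t in nhds 0. (differential_coeff f P \<phi> \<circ> inv_into U \<phi>) t = - (poly Q t / s t)"
    unfolding \<phi> by eventually_elim (simp add: Q del: infinity_patch.simps)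
  moreover have "(\<lambda>t. - (poly Q t / s t)) analytic_on {0}"
    using s \<open>v \<noteq> 0\<close> by (intro analytic_intros) auto
  ultimately have "(differential_coeff f P \<phi> \<circ> inv_into U \<phi>) analytic_on {0}"
    using analytic_at_cong[OF cong refl] by blast
  then show ?thesis using \<phi> Infinity by simp
qed

lemma poly_differential_holomorphic:
  assumes "f \<noteq> 0" "even (degree f)" "degree P + 2 \<le> degree f div 2"
  shows "poly_differential f P \<in> holomorphic_differentials (hyperelliptic_curve f)"
  unfolding holomorphic_differentials_def hyperelliptic_curve_def surface.select_convs mem_Collect_eq
proof (intro conjI allI ballI impI)
  fix c p assume "\<not> (c \<in> curve_atlas f \<and> p \<in> fst c)"
  then show "poly_differential f P c p = 0"
    by (cases c) (auto simp: poly_differential_def)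
next
  have "(poly_differential f P (U, \<phi>) \<circ> inv_into U \<phi>) holomorphic_on \<phi> ` U"
    if c: "(U, \<phi>) \<in> curve_atlas f" for U \<phi>
  proof -
    have "(differential_coeff f P \<phi> \<circ> inv_into U \<phi>) analytic_on (\<phi> ` U)"
      using differential_coeff_analytic[OF assms c]
      by (subst analytic_on_analytic_at) auto
    then have "(differential_coeff f P \<phi> \<circ> inv_into U \<phi>) holomorphic_on (\<phi> ` U)"
      by (rule analytic_imp_holomorphic)
    then show ?thesis
      by (rule holomorphic_transform) (auto simp: poly_differential_eq[OF c] inv_into_into)
  qed
  then show "case c of (U, \<phi>) \<Rightarrow> (poly_differential f P (U, \<phi>) \<circ> inv_into U \<phi>) holomorphic_on \<phi> ` U"
    if "c \<in> curve_atlas f" for c using that by (cases c) simp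
next
  have transition: "poly_differential f P (U, \<phi>) p =
      poly_differential f P (V, \<psi>) p * deriv (\<psi> \<circ> inv_into U \<phi>) (\<phi> p)"
    if "(U, \<phi>) \<in> curve_atlas f" "(V, \<psi>) \<in> curve_atlas f" "p \<in> U" "p \<in> V" for U \<phi> V \<psi> p
    unfolding poly_differential_eq[OF that(1,3)] poly_differential_eq[OF that(2,4)]
    by (rule differential_coeff_transition[OF assms(1,2) that])
  show "case c of (U, \<phi>) \<Rightarrow> \<forall>(V, \<psi>)\<in>curve_atlas f. \<forall>p\<in>U \<inter> V. poly_differential f P (U, \<phi>) p =
      poly_differential f P (V, \<psi>) p * deriv (\<psi> \<circ> inv_into U \<phi>) (\<phi> p)"
    if "c \<in> curve_atlas f" for c
    using that by clarify (rule transition; simp)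
qed

section \<open>All holomorphic differentials are polynomial\<close>

lemma holomorphic_differentials_outside:
  "\<omega> \<in> holomorphic_differentials S \<Longrightarrow> \<not> (c \<in> atlas S \<and> p \<in> fst c) \<Longrightarrow> \<omega> c p = 0"
  unfolding holomorphic_differentials_def by blast

lemma holomorphic_differentials_cong:
  assumes "\<omega> \<in> holomorphic_differentials (hyperelliptic_curve f)"
    and "\<eta> \<in> holomorphic_differentials (hyperelliptic_curve f)"
    and "\<And>U \<phi> p. (U, \<phi>) \<in> curve_atlas f \<Longrightarrow> p \<in> U \<Longrightarrow> \<omega> (U, \<phi>) p = \<eta> (U, \<phi>) p"
  shows "\<omega> = \<eta>"
proof (intro ext)
  fix c p
  show "\<omega> c p = \<eta> c p"
  proof (cases "c \<in> curve_atlas f \<and> p \<in> fst c")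
    case True
    then show ?thesis using assms(3)[of "fst c" "snd c" p] by simp
  next
    case False
    then have "\<omega> c p = 0" "\<eta> c p = 0"
      using holomorphic_differentials_outside[OF assms(1)] holomorphic_differentials_outside[OF assms(2)]
      by (simp_all add: hyperelliptic_curve_def)
    then show ?thesis by simp
  qed
qed

lemma card_roots_rsquarefree:
  fixes f :: "complex poly"
  assumes "rsquarefree f"
  shows "card {z. poly f z = 0} = degree f"
proof -
  have "lead_coeff f \<noteq> 0" using assms by (auto simp: rsquarefree_def)
  then have "degree f = degree (\<Prod>z | poly f z = 0. [:- z, 1:])"
    by (metis complex_poly_decompose_rsquarefree[OF assms] degree_smult_eq)
  then show ?thesis by (subst (asm) degree_prod_sum_eq) auto
qed

lemma entire_polynomial_growth:
  assumes "g holomorphic_on UNIV" "\<And>z. B \<le> norm z \<Longrightarrow> norm (g z) \<le> C * norm z ^ n"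
  obtains P where "degree P \<le> n" "\<And>z. g z = poly P z"
proof
  define P where "P = (\<Sum>i\<le>n. monom ((deriv ^^ i) g 0 / fact i) i)"
  show "degree P \<le> n"
    unfolding P_def by (intro degree_sum_le) (auto intro: order.trans[OF degree_monom_le])
  show "g z = poly P z" for z
    using Liouville_polynomial[OF assms] by (simp add: P_def poly_sum poly_monom)
qed

text \<open>The genus is \<open>k - 1\<close> for \<open>k = degree f div 2\<close>. The bound
  \<open>2 \<le> k\<close> makes it positive: \<open>dz/w\<close> is then holomorphic, and the
  natural-number subtraction \<open>k - 2\<close> is exact.\<close>

locale smooth_hyperelliptic =
  fixes f :: "complex poly"
  assumes rsquarefree: "rsquarefree f" and even_degree: "even (degree f)"
    and degree_ge: "2 \<le> degree f div 2"
begin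

lemma nonzero: "f \<noteq> 0"
  using rsquarefree by (auto simp: rsquarefree_def)

lemma eventually_mem_chart_image:
  assumes "(U, \<phi>) \<in> curve_atlas f" "p \<in> U"
  shows "\<forall>\<^sub>F t in nhds (\<phi> p). t \<in> \<phi> ` U"
proof (cases p)
  case (Affine z w)
  have mem: "Affine z w \<in> U" "\<phi> p = \<phi> (Affine z w)" using assms(2) Affine by simp_all
  obtain a b where ab: "a analytic_on {\<phi> p}" "b analytic_on {\<phi> p}" "a (\<phi> p) = z" "b (\<phi> p) = w"
    "\<forall>\<^sub>F t in nhds (\<phi> p). (b t)\<^sup>2 = poly f (a t)"
    "\<forall>\<^sub>F t in nhds (\<phi> p). Affine (a t) (b t) \<in> U"
    "\<forall>\<^sub>F t in nhds (\<phi> p). inv_into U \<phi> t = Affine (a t) (b t)"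
    "\<forall>\<^sub>F t in nhds (\<phi> p). \<phi> (Affine (a t) (b t)) = t"
    by (rule affine_chart_curve[OF even_degree assms(1) mem])
  show ?thesis
    using ab(6,8) by eventually_elim (metis imageI)
next
  case (Infinity v)
  have \<phi>: "\<phi> = u_coord" using assms by (cases rule: curve_atlas_cases) (auto simp: Infinity)
  have "v\<^sup>2 = lead_coeff f"
    using assms curve_atlas_subset Infinity infinity_mem_curve_points by blast
  then obtain s where s: "s analytic_on {0}" "s 0 = v" "\<And>t. (s t)\<^sup>2 = poly (reflect_poly f) t"
    using reflect_poly_sqrt_at_0 nonzero by metis
  have "\<forall>\<^sub>F t in nhds 0. infinity_patch f (t, s t) \<in> U \<and> inv_into U u_coord t = infinity_patch f (t, s t)"
    by (rule eventually_infinity_chart) (use assms s Infinity \<phi> in auto)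
  then have "\<forall>\<^sub>F t in nhds 0. t \<in> u_coord ` U"
    by eventually_elim (metis imageI u_coord_infinity_patch)
  then show ?thesis by (simp add: \<phi> Infinity)
qed

lemma open_chart_image: "(U, \<phi>) \<in> curve_atlas f \<Longrightarrow> open (\<phi> ` U)"
proof (subst open_subopen, safe)
  fix p assume "(U, \<phi>) \<in> curve_atlas f" "p \<in> U"
  then show "\<exists>T. open T \<and> \<phi> p \<in> T \<and> T \<subseteq> \<phi> ` U"
    using eventually_mem_chart_image[of U \<phi> p] by (simp add: eventually_nhds subset_iff Ball_def)
qed

end

locale smooth_hyperelliptic_differential = smooth_hyperelliptic +
  fixes \<omega>
  assumes \<omega>: "\<omega> \<in> holomorphic_differentials (hyperelliptic_curve f)"
begin

lemma coeff_analytic: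
  assumes "(U, \<phi>) \<in> curve_atlas f" "p \<in> U"
  shows "(\<omega> (U, \<phi>) \<circ> inv_into U \<phi>) analytic_on {\<phi> p}"
proof -
  have "(\<omega> (U, \<phi>) \<circ> inv_into U \<phi>) holomorphic_on \<phi> ` U"
    using \<omega> assms(1) by (auto simp: holomorphic_differentials_def hyperelliptic_curve_def)
  then have "(\<omega> (U, \<phi>) \<circ> inv_into U \<phi>) analytic_on \<phi> ` U"
    using open_chart_image[OF assms(1)] by (simp add: analytic_on_open)
  then show ?thesis by (rule analytic_on_subset) (use assms in auto)
qed

lemma transition:
  assumes "(U, \<phi>) \<in> curve_atlas f" "(V, \<psi>) \<in> curve_atlas f" "p \<in> U" "p \<in> V"
  shows "\<omega> (U, \<phi>) p = \<omega> (V, \<psi>) p * deriv (\<psi> \<circ> inv_into U \<phi>) (\<phi> p)"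
proof -
  have "\<forall>(U, \<phi>) \<in> curve_atlas f. \<forall>(V, \<psi>) \<in> curve_atlas f. \<forall>p \<in> U \<inter> V.
           \<omega> (U, \<phi>) p = \<omega> (V, \<psi>) p * deriv (\<psi> \<circ> inv_into U \<phi>) (\<phi> p)"
    using \<omega> by (simp add: holomorphic_differentials_def hyperelliptic_curve_def)
  from bspec[OF bspec[OF this assms(1), unfolded prod.case] assms(2), unfolded prod.case]
  show ?thesis using assms(3,4) by blast
qed

text \<open>The quotient of \<open>\<omega>\<close> by \<open>dz/w\<close>, a function on the affine part of the curve.\<close>

definition ratio :: "complex \<Rightarrow> complex \<Rightarrow> complex" where
  "ratio z w = (let c = chart_at (hyperelliptic_curve f) (Affine z w)
     in \<omega> c (Affine z w) / differential_coeff f 1 (snd c) (Affine z w))"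

text \<open>Under a change of chart the coefficients of \<open>\<omega>\<close> and of
  \<open>dz/w\<close> acquire the same factor, so the quotient does not depend on the chart picked
  by \<open>chart_at\<close>.\<close>

lemma coeff_eq_ratio:
  assumes "(U, \<phi>) \<in> curve_atlas f" "Affine z w \<in> U"
  shows "\<omega> (U, \<phi>) (Affine z w) = ratio z w * differential_coeff f 1 \<phi> (Affine z w)"
proof -
  obtain V \<psi> where c: "chart_at (hyperelliptic_curve f) (Affine z w) = (V, \<psi>)"
    by (cases "chart_at (hyperelliptic_curve f) (Affine z w)")
  have "(V, \<psi>) \<in> atlas (hyperelliptic_curve f) \<and> Affine z w \<in> fst (V, \<psi>)"
    unfolding c[symmetric] chart_at_def
    by (rule someI[of _ "(U, \<phi>)"]) (use assms in \<open>simp add: hyperelliptic_curve_def\<close>)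
  then have V: "(V, \<psi>) \<in> curve_atlas f" "Affine z w \<in> V"
    by (simp_all add: hyperelliptic_curve_def)
  have "differential_coeff f 1 \<psi> (Affine z w) \<noteq> 0"
    using V by (cases rule: curve_atlas_cases) auto
  then show ?thesis
    using transition[OF assms(1) V(1) assms(2) V(2)]
      differential_coeff_transition[OF nonzero even_degree assms(1) V(1) assms(2) V(2), of 1]
    by (simp add: ratio_def c del: differential_coeff.simps)
qed

text \<open>All zeros of \<open>dz/w\<close> lie at infinity, so dividing by it creates no poles on
  the affine part.\<close>

lemma differential_coeff_1_nonzero:
  "(U, \<phi>) \<in> curve_atlas f \<Longrightarrow> Affine z w \<in> U \<Longrightarrow> differential_coeff f 1 \<phi> (Affine z w) \<noteq> 0"
  by (erule (1) curve_atlas_cases) auto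

lemma ratio_analytic_along:
  assumes "(U, \<phi>) \<in> curve_atlas f" "Affine z w \<in> U"
    and "\<forall>\<^sub>F t in nhds (\<phi> (Affine z w)). inv_into U \<phi> t = Affine (a t) (b t) \<and> Affine (a t) (b t) \<in> U"
  shows "(\<lambda>t. ratio (a t) (b t)) analytic_on {\<phi> (Affine z w)}"
proof -
  let ?t = "\<phi> (Affine z w)"
  have inv: "inv_into U \<phi> ?t = Affine z w"
    by (rule inv_into_chart_eq[OF assms(1,2) refl])
  have 1: "(\<omega> (U, \<phi>) \<circ> inv_into U \<phi>) analytic_on {?t}"
    by (rule coeff_analytic[OF assms(1,2)])
  have 2: "(differential_coeff f 1 \<phi> \<circ> inv_into U \<phi>) analytic_on {?t}"
    by (rule differential_coeff_analytic[OF nonzero even_degree _ assms(1,2)]) (use degree_ge in simp)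
  have "(\<lambda>t. (\<omega> (U, \<phi>) \<circ> inv_into U \<phi>) t / (differential_coeff f 1 \<phi> \<circ> inv_into U \<phi>) t)
      analytic_on {?t}"
    using 1 2 differential_coeff_1_nonzero[OF assms(1,2)]
    by (intro analytic_on_divide) (simp_all add: inv del: o_apply differential_coeff.simps, simp add: inv)
  moreover have cong: "\<forall>\<^sub>F t in nhds ?t.
      (\<omega> (U, \<phi>) \<circ> inv_into U \<phi>) t / (differential_coeff f 1 \<phi> \<circ> inv_into U \<phi>) t = ratio (a t) (b t)"
    using assms(3)
  proof eventually_elim
    case (elim t)
    then show ?case
      using coeff_eq_ratio[OF assms(1), of "a t" "b t"] differential_coeff_1_nonzero[OF assms(1), of "a t" "b t"]
      by (simp del: differential_coeff.simps)
  qed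
  ultimately show ?thesis using analytic_at_cong[OF cong refl] by blast
qed

lemma ratio_analytic_branch:
  assumes "s analytic_on {z}" "\<And>t. (s t)\<^sup>2 = poly f t" "s z \<noteq> 0"
  shows "(\<lambda>t. ratio t (s t)) analytic_on {z}"
proof -
  obtain U where U: "(U, z_coord) \<in> curve_atlas f" "Affine z (s z) \<in> U"
    using z_chart_exists[OF even_degree assms(2,3)] by blast
  have "\<forall>\<^sub>F t in nhds z. Affine t (s t) \<in> U"
    by (rule eventually_Affine_mem[OF curve_atlas_openin[OF U(1)] U(2) even_degree])
      (simp_all add: filterlim_ident analytic_at_tendsto[OF assms(1)] assms(2))
  then have "\<forall>\<^sub>F t in nhds z. inv_into U z_coord t = Affine t (s t) \<and> Affine t (s t) \<in> U"
    by eventually_elim (simp add: inv_into_chart_eq[OF U(1)])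
  then show ?thesis
    using ratio_analytic_along[OF U, of "\<lambda>t. t" s] by simp
qed

text \<open>The root \<open>s t\<close> is itself the \<open>w\<close>-coordinate of the point
  \<open>(t, s t)\<close>, so inserting it into the arc of a \<open>w\<close>-chart recovers that
  point. The choice of roots may jump away from \<open>z\<close>, which admits
  \<open>csqrt\<close>.\<close>

lemma ratio_tendsto_branch_point:
  assumes "poly f z = 0" "(s \<longlongrightarrow> 0) (nhds z)" "\<And>t. (s t)\<^sup>2 = poly f t"
  shows "((\<lambda>t. ratio t (s t)) \<longlongrightarrow> ratio z 0) (nhds z)"
proof -
  have "poly (pderiv f) z \<noteq> 0" using rsquarefree assms(1) rsquarefree_roots by blast
  then obtain U where U: "(U, w_coord) \<in> curve_atlas f" "Affine z 0 \<in> U"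
    using w_chart_exists[OF even_degree, of 0 z] assms(1) by auto
  have mem: "Affine z 0 \<in> U" "0 = w_coord (Affine z 0)" using U by simp_all
  obtain a b where ab: "a analytic_on {0}" "b analytic_on {0}" "a 0 = z" "b 0 = 0"
    "\<forall>\<^sub>F t in nhds 0. (b t)\<^sup>2 = poly f (a t)"
    "\<forall>\<^sub>F t in nhds 0. Affine (a t) (b t) \<in> U"
    "\<forall>\<^sub>F t in nhds 0. inv_into U w_coord t = Affine (a t) (b t)"
    "\<forall>\<^sub>F t in nhds 0. w_coord (Affine (a t) (b t)) = t"
    by (rule affine_chart_curve[OF even_degree U(1) mem])
  have "(\<lambda>t. ratio (a t) (b t)) analytic_on {w_coord (Affine z 0)}"
    by (rule ratio_analytic_along[OF U]) (use eventually_conj[OF ab(7,6)] in simp)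
  then have "((\<lambda>t. ratio (a t) (b t)) \<longlongrightarrow> ratio z 0) (nhds 0)"
    using analytic_at_tendsto[of "\<lambda>t. ratio (a t) (b t)" 0] ab(3,4) by simp
  then have "((\<lambda>t. ratio (a (s t)) (b (s t))) \<longlongrightarrow> ratio z 0) (nhds z)"
    by (rule filterlim_compose[OF _ assms(2)])
  moreover have "\<forall>\<^sub>F t in nhds z. ratio (a (s t)) (b (s t)) = ratio t (s t)"
  proof -
    have "\<forall>\<^sub>F t in nhds z. Affine t (s t) \<in> U"
      by (rule eventually_Affine_mem[OF curve_atlas_openin[OF U(1)] U(2) even_degree])
        (simp_all add: filterlim_ident assms)
    moreover have "\<forall>\<^sub>F t in nhds z. inv_into U w_coord (s t) = Affine (a (s t)) (b (s t))"
      by (rule eventually_compose_filterlim[OF ab(7) assms(2)])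
    ultimately show ?thesis
    proof eventually_elim
      case (elim t)
      then show ?case using inv_into_chart_eq[OF U(1) elim(1), of "s t"] by simp
    qed
  qed
  ultimately show ?thesis by (rule Lim_transform_eventually)
qed

text \<open>Symmetry of \<open>G\<close> hides the jumps of \<open>csqrt\<close>: near any non-root
  of \<open>f\<close> it can be replaced by an analytic root. At the roots continuity suffices. The
  instances of \<open>G\<close> are \<open>(x - y)^2\<close> and \<open>x + y\<close>.\<close>

lemma symmetric_ratio_entire:
  assumes sym: "\<And>x y. G x y = G y x" and G: "\<And>g h S. g analytic_on S \<Longrightarrow> h analytic_on S \<Longrightarrow> (\<lambda>t. G (g t) (h t)) analytic_on S"
    and Gc: "\<And>g h x y. \<And>F :: complex filter. (g \<longlongrightarrow> x) F \<Longrightarrow> (h \<longlongrightarrow> y) F \<Longrightarrow> ((\<lambda>t. G (g t) (h t)) \<longlongrightarrow> G x y) F"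
  shows "(\<lambda>z. G (ratio z (csqrt (poly f z))) (ratio z (- csqrt (poly f z)))) holomorphic_on UNIV"
    (is "?A holomorphic_on _")
proof (rule no_isolated_singularity'[where K = "{z. poly f z = 0}"])
  show "finite {z. poly f z = 0}" using nonzero poly_roots_finite by blast
  show "open (UNIV :: complex set)" by simp
  have "?A analytic_on {z}" if nz: "poly f z \<noteq> 0" for z
  proof -
    obtain s where s: "s analytic_on {z}" "s z = csqrt (poly f z)" "\<And>t. (s t)\<^sup>2 = poly f t"
      by (rule poly_analytic_sqrt[of "csqrt (poly f z)" f z]) (simp_all add: nz)
    have "?A t = G (ratio t (s t)) (ratio t (- s t))" for t
    proof -
      have "csqrt (poly f t) = s t \<or> csqrt (poly f t) = - s t"
        using s(3)[of t] power2_eq_iff[of "csqrt (poly f t)" "s t"] by simp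
      then show ?thesis using sym by force
    qed
    moreover have "(\<lambda>t. ratio t (s t)) analytic_on {z}" "(\<lambda>t. ratio t (- s t)) analytic_on {z}"
      using s(1,3) nz by (intro ratio_analytic_branch analytic_on_neg; simp add: s(2))+
    ultimately show ?thesis using G by presburger
  qed
  then show "?A holomorphic_on UNIV - {z. poly f z = 0}"
    by (intro analytic_imp_holomorphic) (subst analytic_on_analytic_at, blast)
  fix z assume "z \<in> {z. poly f z = 0}"
  then have z: "poly f z = 0" by simp
  \<comment> \<open>The value 0 lies on the cut of \<open>csqrt\<close>, so convergence to 0 is read
    off from the norm, which is a real square root.\<close>
  have "((\<lambda>t. sqrt (norm (poly f t))) \<longlongrightarrow> sqrt (norm (poly f z))) (nhds z)"
    by (intro tendsto_intros filterlim_ident)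
  then have "((\<lambda>t. norm (csqrt (poly f t))) \<longlongrightarrow> 0) (nhds z)" by (simp add: z)
  then have 1: "((\<lambda>t. csqrt (poly f t)) \<longlongrightarrow> 0) (nhds z)" by (rule tendsto_norm_zero_cancel)
  then have 2: "((\<lambda>t. - csqrt (poly f t)) \<longlongrightarrow> 0) (nhds z)" using tendsto_minus by fastforce
  have "(?A \<longlongrightarrow> G (ratio z 0) (ratio z 0)) (nhds z)"
    by (intro Gc; rule ratio_tendsto_branch_point[OF z]) (simp_all add: 1 2)
  then have "(?A \<longlongrightarrow> ?A z) (nhds z)" by (simp add: z)
  then show "(?A \<longlongrightarrow> ?A z) (at z within UNIV)"
    using tendsto_at_iff_tendsto_nhds by blast
qed

text \<open>In the \<open>u\<close>-chart \<open>\<omega>\<close> has a locally bounded coefficient,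
  whereas \<open>dz/w\<close> has the coefficient \<open>- u^(k-2)/v\<close>. The quotient therefore
  grows at most like \<open>u^(-(k-2)) = z^(k-2)\<close>.\<close>

lemma ratio_growth_branch:
  assumes "v analytic_on {0}" "\<And>t. (v t)\<^sup>2 = poly (reflect_poly f) t"
  obtains C where "\<forall>\<^sub>F t in at 0.
    norm (ratio (1 / t) (v t / t ^ (degree f div 2))) \<le> C * norm (1 / t) ^ (degree f div 2 - 2)"
proof -
  define k where "k = degree f div 2"
  have "(v 0)\<^sup>2 = lead_coeff f" using assms(2)[of 0] by (simp add: poly_0_coeff_0)
  then obtain U where U: "(U, u_coord) \<in> curve_atlas f" "Infinity (v 0) \<in> U"
    using infinity_chart_exists[OF even_degree _ nonzero] by blast
  \<comment> \<open>Up to sign, \<open>g\<close> is the ratio with its pole cleared: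
    \<open>ratio = - g t / t^(k-2)\<close>. It is analytic at 0, hence bounded by
    \<open>norm (g 0) + 1\<close> nearby.\<close>
  define g where "g = (\<lambda>t. \<omega> (U, u_coord) (inv_into U u_coord t) * v t)"
  have "g analytic_on {0}"
    unfolding g_def using coeff_analytic[OF U] assms(1) by (intro analytic_on_mult) (simp_all add: o_def)
  then have "((\<lambda>t. norm (g t)) \<longlongrightarrow> norm (g 0)) (nhds 0)"
    by (intro tendsto_norm analytic_at_tendsto)
  then have "\<forall>\<^sub>F t in nhds 0. norm (g t) < norm (g 0) + 1"
    by (rule order_tendstoD) simp
  moreover have "\<forall>\<^sub>F t in nhds 0.
      infinity_patch f (t, v t) \<in> U \<and> inv_into U u_coord t = infinity_patch f (t, v t)"
    by (rule eventually_infinity_chart[OF U assms])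
  ultimately have "\<forall>\<^sub>F t in at 0. norm (g t) < norm (g 0) + 1 \<and>
      infinity_patch f (t, v t) \<in> U \<and> inv_into U u_coord t = infinity_patch f (t, v t) \<and> t \<noteq> 0"
    unfolding eventually_at_filter by eventually_elim blast
  then have "\<forall>\<^sub>F t in at 0. norm (ratio (1 / t) (v t / t ^ k)) \<le> (norm (g 0) + 1) * norm (1 / t) ^ (k - 2)"
  proof eventually_elim
    case (elim t)
    let ?p = "Affine (1 / t) (v t / t ^ k)"
    have p: "?p \<in> U" "inv_into U u_coord t = ?p" and t: "t \<noteq> 0" using elim by (auto simp: k_def)
    have "k = k - 2 + 2" using degree_ge by (simp add: k_def)
    then have tk: "t ^ k = t ^ (k - 2) * t\<^sup>2" by (metis power_add)
    have "v t \<noteq> 0"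
      using differential_coeff_1_nonzero[OF U(1) p(1)] by auto
    then have "ratio (1 / t) (v t / t ^ k) = \<omega> (U, u_coord) ?p / differential_coeff f 1 u_coord ?p"
      using coeff_eq_ratio[OF U(1) p(1)] differential_coeff_1_nonzero[OF U(1) p(1)]
      by (simp del: differential_coeff.simps)
    also have "\<dots> = - (\<omega> (U, u_coord) ?p * v t / t ^ (k - 2))"
      unfolding tk using t \<open>v t \<noteq> 0\<close> by (simp add: field_simps)
    also have "\<dots> = - (g t * (1 / t) ^ (k - 2))"
      by (simp add: g_def p(2) power_one_over)
    finally have "norm (ratio (1 / t) (v t / t ^ k)) = norm (g t) * norm (1 / t) ^ (k - 2)"
      by (simp only: norm_minus_cancel norm_mult norm_power)
    then show ?case using elim by (simp add: mult_right_mono)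
  qed
  then show thesis using that unfolding k_def by blast
qed

lemma ratio_growth:
  obtains B C where "\<And>z w. w\<^sup>2 = poly f z \<Longrightarrow> B \<le> norm z \<Longrightarrow>
    norm (ratio z w) \<le> C * norm z ^ (degree f div 2 - 2)"
proof -
  define k where "k = degree f div 2"
  obtain v where v: "v analytic_on {0}" "v 0 = csqrt (lead_coeff f)"
      "\<And>t. (v t)\<^sup>2 = poly (reflect_poly f) t"
    using reflect_poly_sqrt_at_0[OF _ nonzero] by (metis power2_csqrt)
  obtain C1 where C1: "\<forall>\<^sub>F t in at 0. norm (ratio (1 / t) (v t / t ^ k)) \<le> C1 * norm (1 / t) ^ (k - 2)"
    unfolding k_def by (rule ratio_growth_branch[OF v(1,3)])
  obtain C2 where C2: "\<forall>\<^sub>F t in at 0. norm (ratio (1 / t) (- v t / t ^ k)) \<le> C2 * norm (1 / t) ^ (k - 2)"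
    unfolding k_def by (rule ratio_growth_branch[of "\<lambda>t. - v t"]) (simp_all add: v analytic_on_neg)
  have "filterlim inverse (at 0) (at_infinity :: complex filter)"
    by (simp add: filterlim_def at_to_infinity)
  then have "\<forall>\<^sub>F z in at_infinity. norm (ratio z (v (1 / z) * z ^ k)) \<le> C1 * norm z ^ (k - 2) \<and>
      norm (ratio z (- v (1 / z) * z ^ k)) \<le> C2 * norm z ^ (k - 2)"
    using eventually_compose_filterlim[OF eventually_conj[OF C1 C2], of inverse at_infinity]
    by (simp add: inverse_eq_divide power_one_over)
  then obtain B where B: "\<And>z. B \<le> norm z \<Longrightarrow> norm (ratio z (v (1 / z) * z ^ k)) \<le> C1 * norm z ^ (k - 2) \<and>
      norm (ratio z (- v (1 / z) * z ^ k)) \<le> C2 * norm z ^ (k - 2)"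
    unfolding eventually_at_infinity by blast
  \<comment> \<open>The roots \<open>v\<close> and \<open>- v\<close> belong to the two points at
    infinity, and together they reach every curve point with \<open>z\<close> large. The bound
    \<open>max B 1\<close> excludes \<open>z = 0\<close>.\<close>
  have "norm (ratio z w) \<le> max C1 C2 * norm z ^ (k - 2)" if "w\<^sup>2 = poly f z" "max B 1 \<le> norm z" for z w
  proof -
    have "z \<noteq> 0" using that(2) by auto
    then have "(v (1 / z) * z ^ k)\<^sup>2 = poly f z"
      using even_degree
      by (simp add: v power_mult_distrib poly_reflect_poly_nz k_def power_one_over flip: power_mult)
    then have "w = v (1 / z) * z ^ k \<or> w = - v (1 / z) * z ^ k"
      using that(1) power2_eq_iff[of w "v (1 / z) * z ^ k"] by simp
    then have "norm (ratio z w) \<le> C1 * norm z ^ (k - 2) \<or> norm (ratio z w) \<le> C2 * norm z ^ (k - 2)"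
      using B[of z] that(2) by auto
    moreover have "C1 * norm z ^ (k - 2) \<le> max C1 C2 * norm z ^ (k - 2)"
      "C2 * norm z ^ (k - 2) \<le> max C1 C2 * norm z ^ (k - 2)"
      by (intro mult_right_mono; simp)+
    ultimately show ?thesis by linarith
  qed
  then show thesis using that unfolding k_def by blast
qed

lemma ratio_eq_poly:
  obtains P where "degree P + 2 \<le> degree f div 2" "\<And>z w. w\<^sup>2 = poly f z \<Longrightarrow> ratio z w = poly P z"
proof -
  define k where "k = degree f div 2"
  define r where "r = (\<lambda>z. ratio z (csqrt (poly f z)))"
  define r' where "r' = (\<lambda>z. ratio z (- csqrt (poly f z)))"
  obtain B C where BC: "\<And>z w. w\<^sup>2 = poly f z \<Longrightarrow> B \<le> norm z \<Longrightarrow> norm (ratio z w) \<le> C * norm z ^ (k - 2)"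
    using ratio_growth unfolding k_def by blast
  have bound: "norm (r z) \<le> C * norm z ^ (k - 2)" "norm (r' z) \<le> C * norm z ^ (k - 2)" if "B \<le> norm z" for z
    unfolding r_def r'_def using that by (auto intro!: BC)
  have D1: "(\<lambda>z. (r z - r' z)\<^sup>2) holomorphic_on UNIV"
    unfolding r_def r'_def
    by (rule symmetric_ratio_entire) (auto intro: analytic_on_diff analytic_on_power tendsto_diff tendsto_power simp: power2_commute)
  have D2: "norm ((r z - r' z)\<^sup>2) \<le> (2 * C)\<^sup>2 * norm z ^ (2 * (k - 2))" if "B \<le> norm z" for z
  proof -
    have "norm (r z - r' z) \<le> 2 * C * norm z ^ (k - 2)"
      using bound[OF that] norm_triangle_ineq4[of "r z" "r' z"] by linarith
    then have "(norm (r z - r' z))\<^sup>2 \<le> (2 * C * norm z ^ (k - 2))\<^sup>2"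
      by (intro power_mono) auto
    then show ?thesis by (simp only: norm_power power_mult_distrib mult.commute[of 2 "k - 2"] power_mult)
  qed
  obtain D where D: "degree D \<le> 2 * (k - 2)" "\<And>z. (r z - r' z)\<^sup>2 = poly D z"
    using entire_polynomial_growth[OF D1 D2] by metis
  have "D = 0"
  proof (rule ccontr)
    assume "D \<noteq> 0"
    have "{z. poly f z = 0} \<subseteq> {z. poly D z = 0}"
      by (auto simp: D(2)[symmetric] r_def r'_def)
    then have "degree f \<le> card {z. poly D z = 0}"
      using card_mono[OF poly_roots_finite[OF \<open>D \<noteq> 0\<close>]] card_roots_rsquarefree[OF rsquarefree] by metis
    also have "\<dots> \<le> 2 * (k - 2)"
      using card_poly_roots_bound[OF \<open>D \<noteq> 0\<close>] D(1) by linarith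
    finally show False using degree_ge even_degree by (auto simp: k_def elim!: evenE)
  qed
  then have rr': "r z = r' z" for z using D(2)[of z] by simp
  have Q1: "(\<lambda>z. r z + r' z) holomorphic_on UNIV"
    unfolding r_def r'_def
    by (rule symmetric_ratio_entire) (auto intro: analytic_on_add tendsto_add simp: add.commute)
  have Q2: "norm (r z + r' z) \<le> 2 * C * norm z ^ (k - 2)" if "B \<le> norm z" for z
    using bound[OF that] norm_triangle_ineq[of "r z" "r' z"] by linarith
  obtain Q where Q: "degree Q \<le> k - 2" "\<And>z. r z + r' z = poly Q z"
    using entire_polynomial_growth[OF Q1 Q2] by metis
  show thesis
  \<comment> \<open>Since \<open>r = r'\<close>, the sum \<open>Q\<close> is twice the
    ratio.\<close>
  proof (rule that[of "smult (1 / 2) Q"])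
    show "degree (smult (1 / 2) Q) + 2 \<le> degree f div 2"
      using Q(1) degree_ge by (simp add: k_def)
    fix z w :: complex assume "w\<^sup>2 = poly f z"
    then have "w = csqrt (poly f z) \<or> w = - csqrt (poly f z)"
      using power2_eq_iff[of w "csqrt (poly f z)"] by simp
    then have "ratio z w = r z" using rr'[of z] by (auto simp: r_def r'_def)
    then show "ratio z w = poly (smult (1 / 2) Q) z"
      using Q(2)[of z] rr'[of z] by (simp add: mult.commute)
  qed
qed

text \<open>The ratio only sees affine points. At infinity both coefficients are continuous in the
  \<open>u\<close>-chart and agree on a punctured neighbourhood, so they agree at the point
  itself.\<close>

theorem eq_poly_differential:
  obtains P where "degree P + 2 \<le> degree f div 2" "\<omega> = poly_differential f P"
proof -
  obtain P where P: "degree P + 2 \<le> degree f div 2" "\<And>z w. w\<^sup>2 = poly f z \<Longrightarrow> ratio z w = poly P z"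
    by (rule ratio_eq_poly) blast
  have affine: "\<omega> (U, \<phi>) (Affine z w) = differential_coeff f P \<phi> (Affine z w)"
    if "(U, \<phi>) \<in> curve_atlas f" "Affine z w \<in> U" for U \<phi> z w
  proof -
    have "w\<^sup>2 = poly f z"
      using that curve_atlas_subset affine_mem_curve_points[OF even_degree] by blast
    then have "\<omega> (U, \<phi>) (Affine z w) = poly P z * differential_coeff f 1 \<phi> (Affine z w)"
      using coeff_eq_ratio[OF that] P(2) by (simp del: differential_coeff.simps)
    then show ?thesis by simp
  qed
  have "\<omega> (U, \<phi>) p = poly_differential f P (U, \<phi>) p" if U: "(U, \<phi>) \<in> curve_atlas f" "p \<in> U" for U \<phi> p
  proof (cases p)
    case (Affine z w)
    then show ?thesis using affine U by (simp add: poly_differential_eq del: differential_coeff.simps)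
  next
    case (Infinity v)
    have \<phi>: "\<phi> = u_coord" using U by (cases rule: curve_atlas_cases) (auto simp: Infinity)
    have "v\<^sup>2 = lead_coeff f"
      using U curve_atlas_subset Infinity infinity_mem_curve_points by blast
    then obtain s where s: "s analytic_on {0}" "s 0 = v" "\<And>t. (s t)\<^sup>2 = poly (reflect_poly f) t"
      using reflect_poly_sqrt_at_0 nonzero by metis
    have ev: "\<forall>\<^sub>F t in nhds 0. infinity_patch f (t, s t) \<in> U \<and> inv_into U u_coord t = infinity_patch f (t, s t)"
      by (rule eventually_infinity_chart) (use U s(1,2) Infinity \<phi> in \<open>simp_all add: s(3)\<close>)
    have inv: "inv_into U u_coord 0 = p"
      using inv_into_chart_eq[OF U] by (simp add: \<phi> Infinity)
    have "\<omega> (U, u_coord) \<circ> inv_into U u_coord analytic_on {0}"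
      using coeff_analytic[OF U] by (simp add: \<phi> Infinity)
    then have 1: "((\<omega> (U, u_coord) \<circ> inv_into U u_coord) \<longlongrightarrow> \<omega> (U, u_coord) p) (at 0)"
      using analytic_at_imp_isCont by (force simp: isCont_def inv)
    have "(differential_coeff f P u_coord \<circ> inv_into U u_coord) analytic_on {0}"
      using differential_coeff_analytic[OF nonzero even_degree P(1) U] by (simp add: \<phi> Infinity)
    then have 2: "((differential_coeff f P u_coord \<circ> inv_into U u_coord) \<longlongrightarrow> differential_coeff f P u_coord p) (at 0)"
      using analytic_at_imp_isCont by (force simp: isCont_def inv)
    have "\<forall>\<^sub>F t in at 0. (\<omega> (U, u_coord) \<circ> inv_into U u_coord) t
        = (differential_coeff f P u_coord \<circ> inv_into U u_coord) t"
      using ev unfolding eventually_at_filter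
    proof eventually_elim
      case (elim t)
      then show ?case using affine[of U u_coord] U(1)
        by (auto simp: \<phi> simp del: differential_coeff.simps)
    qed
    then have "((differential_coeff f P u_coord \<circ> inv_into U u_coord) \<longlongrightarrow> \<omega> (U, u_coord) p) (at 0)"
      using Lim_transform_eventually[OF 1] by blast
    then have "\<omega> (U, u_coord) p = differential_coeff f P u_coord p"
      using 2 by (rule tendsto_unique[rotated]) simp
    then show ?thesis using U by (simp add: \<phi> poly_differential_eq)
  qed
  then have "\<omega> = poly_differential f P"
    by (rule holomorphic_differentials_cong[OF \<omega> poly_differential_holomorphic[OF nonzero even_degree P(1)]])
  then show thesis using that P(1) by blast
qed

end

section \<open>Pullbacks and linear algebra\<close>

context smooth_hyperelliptic
begin

text \<open>Squarefreeness enters at \<open>w = 0\<close>: there \<open>f(z) = 0\<close> forces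
  \<open>f'(z) \<noteq> 0\<close>, so a \<open>w\<close>-chart exists.\<close>

lemma chart_exists:
  assumes "p \<in> curve_points f"
  obtains U \<phi> where "(U, \<phi>) \<in> curve_atlas f" "p \<in> U"
proof (cases p)
  case (Affine z w)
  then have w: "w\<^sup>2 = poly f z" using assms affine_mem_curve_points[OF even_degree] by simp
  show ?thesis
  proof (cases "w = 0")
    case True
    then have "poly (pderiv f) z \<noteq> 0" using w rsquarefree rsquarefree_roots by fastforce
    then show ?thesis using w_chart_exists[OF even_degree w] that Affine by metis
  next
    case False
    then show ?thesis using z_chart_exists[OF even_degree w] that Affine by metis
  qed
next
  case (Infinity v)
  then have "v\<^sup>2 = lead_coeff f" using assms infinity_mem_curve_points by simp
  then show ?thesis using infinity_chart_exists[OF even_degree _ nonzero] that Infinity by metis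
qed

lemma chart_at:
  assumes "p \<in> curve_points f"
  obtains U \<phi> where "chart_at (hyperelliptic_curve f) p = (U, \<phi>)" "(U, \<phi>) \<in> curve_atlas f" "p \<in> U"
proof -
  obtain U \<phi> where "(U, \<phi>) \<in> curve_atlas f" "p \<in> U" using chart_exists[OF assms] .
  then have "chart_at (hyperelliptic_curve f) p \<in> atlas (hyperelliptic_curve f) \<and>
      p \<in> fst (chart_at (hyperelliptic_curve f) p)"
    unfolding chart_at_def
    by (intro someI[of "\<lambda>c. c \<in> atlas (hyperelliptic_curve f) \<and> p \<in> fst c" "(U, \<phi>)"])
      (simp add: hyperelliptic_curve_def)
  moreover obtain V \<psi> where "chart_at (hyperelliptic_curve f) p = (V, \<psi>)"
    by (cases "chart_at (hyperelliptic_curve f) p")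
  ultimately show thesis by (intro that[of V \<psi>]) (simp_all add: hyperelliptic_curve_def)
qed

lemma poly_differential_inject:
  assumes "poly_differential f P = poly_differential f Q"
  shows "P = Q"
proof (rule ccontr)
  assume "P \<noteq> Q"
  have "poly (P - Q) z = 0 \<or> poly f z = 0" for z
  proof (cases "poly f z = 0")
    case False
    then have "(csqrt (poly f z))\<^sup>2 = poly f z" "csqrt (poly f z) \<noteq> 0" by simp_all
    then obtain U where U: "(U, z_coord) \<in> curve_atlas f" "Affine z (csqrt (poly f z)) \<in> U"
      using z_chart_exists[OF even_degree] by blast
    then have "differential_coeff f P z_coord (Affine z (csqrt (poly f z))) =
        differential_coeff f Q z_coord (Affine z (csqrt (poly f z)))"
      using assms poly_differential_eq[OF U] by metis
    then show ?thesis using False by simp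
  qed simp
  \<comment> \<open>The \<open>z\<close>-chart coefficient \<open>P(z)/w\<close> determines
    \<open>P(z)\<close> away from the roots of \<open>f\<close>; the factor \<open>f\<close> absorbs
    these roots.\<close>
  then have "(P - Q) * f = 0"
    using poly_all_0_iff_0[of "(P - Q) * f"] by simp
  then show False using \<open>P \<noteq> Q\<close> nonzero by simp
qed

lemma holomorphic_differentials_eq:
  "holomorphic_differentials (hyperelliptic_curve f) =
    poly_differential f ` {P. degree P + 2 \<le> degree f div 2}"
proof (intro equalityI subsetI)
  fix \<omega> assume "\<omega> \<in> holomorphic_differentials (hyperelliptic_curve f)"
  then interpret smooth_hyperelliptic_differential f \<omega> by unfold_locales
  obtain P where "degree P + 2 \<le> degree f div 2" "\<omega> = poly_differential f P"
    by (rule eq_poly_differential)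
  then show "\<omega> \<in> poly_differential f ` {P. degree P + 2 \<le> degree f div 2}" by blast
qed (use poly_differential_holomorphic[OF nonzero even_degree] in blast)

end

lemma poly_differential_add: "poly_differential f (P + Q) = poly_differential f P + poly_differential f Q"
proof -
  have "differential_coeff f (P + Q) \<phi> p = differential_coeff f P \<phi> p + differential_coeff f Q \<phi> p" for \<phi> p
    by (cases p) (auto simp: add_divide_distrib algebra_simps)
  then show ?thesis
    by (auto simp: poly_differential_def fun_eq_iff plus_fun_def)
qed

lemma poly_differential_smult: "poly_differential f (smult a P) = scale_diff a (poly_differential f P)"
proof -
  have "differential_coeff f (smult a P) \<phi> p = a * differential_coeff f P \<phi> p" for \<phi> p
    by (cases p) auto
  then show ?thesis
    by (auto simp: poly_differential_def fun_eq_iff scale_diff_def)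
qed

text \<open>The map \<open>z -> c z^m\<close> covers both the quotient projection
  (\<open>c = 1\<close>, \<open>m = 2\<close>) and the involution (\<open>c = -1\<close>,
  \<open>m = 1\<close>). As \<open>w\<close> is unchanged, \<open>R\<close> is
  \<open>P(c z^m)\<close> times the derivative of \<open>c z^m\<close>. At infinity \<open>v\<close>
  is fixed and \<open>u\<close> becomes \<open>u^m / c\<close>, whence the condition
  \<open>R_inf\<close>.\<close>

lemma pullback_poly_differential:
  assumes f: "smooth_hyperelliptic f" and g: "smooth_hyperelliptic g"
    and F: "\<And>z w. F (Affine z w) = Affine (c * z ^ m) w" "\<And>v. F (Infinity v) = Infinity v"
    and m: "m > 0" "c \<noteq> 0" and fg: "\<And>z. poly f z = poly g (c * z ^ m)" "lead_coeff f = lead_coeff g"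
    and R: "\<And>z. poly R z = of_nat m * c * z ^ (m - 1) * poly P (c * z ^ m)"
    and R_inf: "coeff R (degree f div 2 - 2) = coeff P (degree g div 2 - 2) * of_nat m * 0 ^ (m - 1) / c"
  shows "pullback (hyperelliptic_curve f) (hyperelliptic_curve g) F (poly_differential g P) =
    poly_differential f R"
proof (intro ext)
  fix C p
  interpret f: smooth_hyperelliptic f by (rule f)
  interpret g: smooth_hyperelliptic g by (rule g)
  show "pullback (hyperelliptic_curve f) (hyperelliptic_curve g) F (poly_differential g P) C p =
    poly_differential f R C p"
  proof (cases "C \<in> curve_atlas f \<and> p \<in> fst C")
    case False
    then show ?thesis
      by (cases C) (auto simp: pullback_def poly_differential_def hyperelliptic_curve_def)
  next
    case True
    obtain U \<phi> where C: "C = (U, \<phi>)" by (cases C)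
    with True have U: "(U, \<phi>) \<in> curve_atlas f" "p \<in> U" by simp_all
    have "p \<in> curve_points f" using U curve_atlas_subset by blast
    then have "F p \<in> curve_points g"
      by (cases p) (simp_all add: F fg affine_mem_curve_points f.even_degree g.even_degree infinity_mem_curve_points)
    then obtain V \<psi> where V: "chart_at (hyperelliptic_curve g) (F p) = (V, \<psi>)"
      "(V, \<psi>) \<in> curve_atlas g" "F p \<in> V"
      by (rule g.chart_at)
    have pull: "pullback (hyperelliptic_curve f) (hyperelliptic_curve g) F (poly_differential g P) C p =
        differential_coeff g P \<psi> (F p) * deriv (\<psi> \<circ> F \<circ> inv_into U \<phi>) (\<phi> p)"
      using U V by (simp add: pullback_def C hyperelliptic_curve_def poly_differential_eq)
    have "differential_coeff g P \<psi> (F p) * deriv (\<psi> \<circ> F \<circ> inv_into U \<phi>) (\<phi> p) = differential_coeff f R \<phi> p"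
    proof (cases p)
      case (Affine z w)
      define t0 where "t0 = \<phi> p"
      have mem: "Affine z w \<in> U" "t0 = \<phi> (Affine z w)" using U Affine t0_def by simp_all
      obtain a b where ab: "a analytic_on {t0}" "b analytic_on {t0}" "a t0 = z" "b t0 = w"
        "\<forall>\<^sub>F t in nhds t0. (b t)\<^sup>2 = poly f (a t)"
        "\<forall>\<^sub>F t in nhds t0. Affine (a t) (b t) \<in> U"
        "\<forall>\<^sub>F t in nhds t0. inv_into U \<phi> t = Affine (a t) (b t)"
        "\<forall>\<^sub>F t in nhds t0. \<phi> (Affine (a t) (b t)) = t"
        by (rule affine_chart_curve[OF f.even_degree U(1) mem])
      define q where "q = of_nat m * c * z ^ (m - 1)"
      have q: "((\<lambda>z. c * z ^ m) has_field_derivative q) (at z)"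
        by (auto intro!: derivative_eq_intros simp: q_def)
      have der_a: "(a has_field_derivative deriv a t0) (at t0)"
        and der_b: "(b has_field_derivative deriv b t0) (at t0)"
        by (rule analytic_at_has_field_derivative, rule ab)+
      have der_qa: "((\<lambda>t. c * a t ^ m) has_field_derivative q * deriv a t0) (at t0)"
        by (rule DERIV_chain2[OF _ der_a]) (simp add: ab q)
      have eq: "\<forall>\<^sub>F t in nhds t0. (b t)\<^sup>2 = poly g (c * a t ^ m)"
        using ab(5) by (simp add: fg)
      have "((\<lambda>z. poly g (c * z ^ m)) has_field_derivative poly (pderiv g) (c * z ^ m) * q) (at z)"
        by (rule DERIV_chain2[OF poly_DERIV q])
      then have pderiv: "poly (pderiv f) z = poly (pderiv g) (c * z ^ m) * q"
        using poly_DERIV[of f z] by (auto simp: fg dest: DERIV_unique)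
      have "deriv (\<psi> \<circ> F \<circ> inv_into U \<phi>) t0 = deriv (\<lambda>t. \<psi> (Affine (c * a t ^ m) (b t))) t0"
        by (rule deriv_cong_ev[OF eventually_mono[OF ab(7)] refl]) (simp add: F)
      then have "differential_coeff g P \<psi> (F p) * deriv (\<psi> \<circ> F \<circ> inv_into U \<phi>) t0 =
          (if w \<noteq> 0 then poly P (c * z ^ m) * (q * deriv a t0) / w
           else 2 * poly P (c * z ^ m) * deriv b t0 / poly (pderiv g) (c * z ^ m))"
        using differential_coeff_along_curve[OF V(2) _ der_qa der_b eq, of P] V(3)
        by (simp only: Affine F ab(3,4))
      also have "\<dots> = (if w \<noteq> 0 then poly R z * deriv a t0 / w
           else 2 * poly R z * deriv b t0 / poly (pderiv f) z)"
      proof (cases "w = 0")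
        case True
        then have "poly f z = 0"
          using \<open>p \<in> curve_points f\<close> Affine affine_mem_curve_points[OF f.even_degree] by simp
        \<comment> \<open>Because \<open>f'(z)\<close> is \<open>g'(c z^m)\<close> times
          \<open>q\<close>, its nonvanishing forces \<open>q \<noteq> 0\<close>, and
          \<open>q\<close> cancels from the quotient of \<open>R\<close> by
          \<open>f'\<close>.\<close>
        then have "poly (pderiv f) z \<noteq> 0" using f.rsquarefree rsquarefree_roots by blast
        then show ?thesis using True by (auto simp: pderiv R q_def)
      qed (simp add: R q_def)
      also have "\<dots> = differential_coeff f R \<phi> p * deriv (\<lambda>t. \<phi> (Affine (a t) (b t))) t0"
        using differential_coeff_along_curve[OF U(1) _ der_a der_b ab(5), of R] mem(1)
        by (simp only: Affine ab(3,4))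
      also have "deriv (\<lambda>t. \<phi> (Affine (a t) (b t))) t0 = deriv (\<lambda>t. t) t0"
        by (rule deriv_cong_ev[OF ab(8) refl])
      finally show ?thesis by (simp only: t0_def[symmetric] deriv_ident mult_1_right)
    next
      case (Infinity v)
      have \<phi>: "\<phi> = u_coord" using U by (cases rule: curve_atlas_cases) (auto simp: Infinity)
      have \<psi>: "\<psi> = u_coord" using V(2,3) by (cases rule: curve_atlas_cases) (auto simp: Infinity F)
      have "v\<^sup>2 = lead_coeff f"
        using \<open>p \<in> curve_points f\<close> Infinity infinity_mem_curve_points by blast
      then obtain s where s: "s analytic_on {0}" "s 0 = v" "\<And>t. (s t)\<^sup>2 = poly (reflect_poly f) t"
        using reflect_poly_sqrt_at_0 f.nonzero by metis
      have "\<forall>\<^sub>F t in nhds 0. infinity_patch f (t, s t) \<in> U \<and> inv_into U u_coord t = infinity_patch f (t, s t)"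
        by (rule eventually_infinity_chart) (use U s(1,2) Infinity \<phi> in \<open>simp_all add: s(3)\<close>)
      then have "\<forall>\<^sub>F t in nhds 0. (u_coord \<circ> F \<circ> inv_into U u_coord) t = t ^ m / c"
        by eventually_elim (use m(1) in \<open>auto simp: F power_one_over\<close>)
      then have "deriv (u_coord \<circ> F \<circ> inv_into U u_coord) 0 = deriv (\<lambda>t. t ^ m / c) 0"
        by (rule deriv_cong_ev) simp
      \<comment> \<open>With the convention \<open>0 ^ 0 = 1\<close> this is \<open>1 / c\<close>
        for \<open>m = 1\<close>, and it vanishes for \<open>m > 1\<close>, where the map ramifies
        at infinity.\<close>
      also have "\<dots> = of_nat m * 0 ^ (m - 1) / c"
        by (rule DERIV_imp_deriv) (use m in \<open>auto intro!: derivative_eq_intros\<close>)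
      finally show ?thesis
        by (simp add: Infinity \<phi> \<psi> F R_inf mult_ac)
    qed
    then show ?thesis using pull U by (simp add: C poly_differential_eq)
  qed
qed

lemma diff_subspace_poly_image:
  fixes T :: "complex poly \<Rightarrow> 'a differential"
  assumes "\<And>P Q. T (P + Q) = T P + T Q" "\<And>a P. T (smult a P) = scale_diff a (T P)" "n > 0"
  shows "diff.subspace (T ` {P. degree P + 1 \<le> n})"
proof (rule diff.subspaceI)
  have "T 0 = 0" using assms(2)[of 0 0] by (simp add: scale_diff_def fun_eq_iff)
  then show "0 \<in> T ` {P. degree P + 1 \<le> n}"
    using \<open>n > 0\<close> by (intro image_eqI[of _ _ 0]) simp_all
next
  fix x y assume "x \<in> T ` {P. degree P + 1 \<le> n}" "y \<in> T ` {P. degree P + 1 \<le> n}"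
  then obtain P Q where "x = T P" "y = T Q" "degree P + 1 \<le> n" "degree Q + 1 \<le> n" by blast
  then show "x + y \<in> T ` {P. degree P + 1 \<le> n}"
    using degree_add_le_max[of P Q] by (intro image_eqI[of _ _ "P + Q"]) (auto simp: assms(1))
next
  fix a x assume "x \<in> T ` {P. degree P + 1 \<le> n}"
  then obtain P where "x = T P" "degree P + 1 \<le> n" by blast
  then show "scale_diff a x \<in> T ` {P. degree P + 1 \<le> n}"
    using degree_smult_le[of a P] by (intro image_eqI[of _ _ "smult a P"]) (auto simp: assms(2))
qed

text \<open>The images of the monomials \<open>1, x, ..., x^(n-1)\<close> form a basis: injectivity
  of \<open>T\<close> turns a vanishing combination into the zero polynomial.\<close>

lemma diff_dim_poly_image:
  fixes T :: "complex poly \<Rightarrow> 'a differential"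
  assumes add: "\<And>P Q. T (P + Q) = T P + T Q" and smult: "\<And>a P. T (smult a P) = scale_diff a (T P)"
    and inj: "inj_on T {P. degree P + 1 \<le> n}" and "n > 0"
  shows "diff.dim (T ` {P. degree P + 1 \<le> n}) = n"
proof -
  let ?V = "T ` {P. degree P + 1 \<le> n}"
  let ?e = "\<lambda>i. T (monom 1 i)"
  have T0: "T 0 = 0" using smult[of 0 0] by (simp add: scale_diff_def fun_eq_iff)
  have sum: "(\<Sum>i<n. scale_diff (c i) (?e i)) = T (\<Sum>i<n. monom (c i) i)" for c
  proof -
    have "T (sum h A) = (\<Sum>i\<in>A. T (h i))" if "finite A" for h and A :: "nat set"
      using that by induction (simp_all add: T0 add)
    then show ?thesis by (simp add: smult[symmetric] smult_monom)
  qed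
  have deg: "degree (\<Sum>i<n. monom (c i) i) + 1 \<le> n" for c :: "nat \<Rightarrow> complex"
  proof -
    have "degree (\<Sum>i<n. monom (c i) i) \<le> n - 1"
      by (intro degree_sum_le) (auto intro: order.trans[OF degree_monom_le])
    then show ?thesis using \<open>n > 0\<close> by simp
  qed
  have coeff: "coeff (\<Sum>i<n. monom (c i) i) j = c j" if "j < n" for c :: "nat \<Rightarrow> complex" and j
    using that by (simp add: coeff_sum)
  have zero: "c j = 0" if "(\<Sum>i<n. scale_diff (c i) (?e i)) = 0" "j < n" for c j
  proof -
    have "T (\<Sum>i<n. monom (c i) i) = T 0" using that(1) by (simp add: sum T0)
    then have "(\<Sum>i<n. monom (c i) i) = 0"
      by (rule inj_onD[OF inj]) (use deg[of c] \<open>n > 0\<close> in auto)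
    then show "c j = 0" using coeff[OF that(2), of c] by simp
  qed
  have inj_e: "inj_on ?e {..<n}"
  proof (rule inj_onI)
    fix i j assume "i \<in> {..<n}" "j \<in> {..<n}" "?e i = ?e j"
    then have "monom (1 :: complex) i = monom 1 j"
      by (intro inj_onD[OF inj]) (auto simp: degree_monom_eq)
    then show "i = j" by (metis degree_monom_eq one_neq_zero)
  qed
  have "diff.independent (?e ` {..<n})"
  proof (rule diff.independent_if_scalars_zero)
    fix u x assume "(\<Sum>x\<in>?e ` {..<n}. scale_diff (u x) x) = 0" "x \<in> ?e ` {..<n}"
    then show "u x = 0"
      using zero[of "\<lambda>i. u (?e i)"] by (auto simp: sum.reindex[OF inj_e])
  qed simp
  moreover have "?e ` {..<n} \<subseteq> ?V"
    by (auto simp: degree_monom_eq)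
  moreover have "?V \<subseteq> diff.span (?e ` {..<n})"
  proof clarify
    fix P :: "complex poly" assume "degree P + 1 \<le> n"
    then have "P = (\<Sum>i<n. monom (coeff P i) i)"
      using coeff[of _ "coeff P"] coeff_eq_0[of P] by (intro poly_eqI) (auto simp: coeff_sum)
    then have "T P = (\<Sum>i<n. scale_diff (coeff P i) (?e i))" by (simp add: sum)
    also have "\<dots> \<in> diff.span (?e ` {..<n})"
      by (intro diff.span_sum diff.span_scale diff.span_base) auto
    finally show "T P \<in> diff.span (?e ` {..<n})" .
  qed
  ultimately have "diff.dim ?V = card (?e ` {..<n})"
    by (intro diff.dim_unique[OF _ _ _ refl])
  then show ?thesis by (simp add: card_image[OF inj_e])
qed

section \<open>The symmetric curve\<close>

lemma pullback_add: "pullback S T F (\<omega> + \<eta>) = pullback S T F \<omega> + pullback S T F \<eta>"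
  by (simp add: pullback_def fun_eq_iff plus_fun_def Let_def distrib_right)

lemma pullback_scale: "pullback S T F (scale_diff a \<omega>) = scale_diff a (pullback S T F \<omega>)"
  by (simp add: pullback_def fun_eq_iff scale_diff_def Let_def)

text \<open>At a root \<open>a\<close> the product rule leaves only the product of the other factors
  at \<open>a\<close>, which is nonzero because the roots form a set.\<close>

lemma rsquarefree_prod_roots:
  fixes A :: "'a :: field_char_0 set"
  assumes "finite A"
  shows "rsquarefree (\<Prod>r\<in>A. [:- r, 1:])"
  unfolding rsquarefree_roots
proof (intro allI notI; elim conjE)
  fix a assume a: "poly (\<Prod>r\<in>A. [:- r, 1:]) a = 0" and d: "poly (pderiv (\<Prod>r\<in>A. [:- r, 1:])) a = 0"
  then have "a \<in> A" using assms by (auto simp: poly_prod)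
  define q where "q = (\<Prod>r\<in>A - {a}. [:- r, 1:])"
  have eq: "(\<Prod>r\<in>A. [:- r, 1:]) = [:- a, 1:] * q"
    unfolding q_def by (rule prod.remove[OF assms \<open>a \<in> A\<close>])
  then have "poly q a = 0" using d unfolding eq pderiv_mult by (simp add: pderiv_pCons del: mult_pCons_left)
  then show False using assms by (auto simp: q_def poly_prod)
qed

text \<open>This is \<open>2 z P(z\<^sup>2)\<close> for \<open>P\<close> of degree less than \<open>n\<close>; higher coefficients are cut off.\<close>

definition odd_lift :: "nat \<Rightarrow> complex poly \<Rightarrow> complex poly" where
  "odd_lift n P = (\<Sum>i<n. monom (2 * coeff P i) (2 * i + 1))"

lemma odd_lift_add: "odd_lift n (P + Q) = odd_lift n P + odd_lift n Q"
  by (simp add: odd_lift_def distrib_left add_monom[symmetric] sum.distrib)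

lemma coeff_odd_lift: "coeff (odd_lift n P) j = (if odd j \<and> j div 2 < n then 2 * coeff P (j div 2) else 0)"
proof -
  have "coeff (odd_lift n P) j = (\<Sum>i<n. if 2 * i + 1 = j then 2 * coeff P i else 0)"
    by (simp add: odd_lift_def coeff_sum)
  also have "\<dots> = (\<Sum>i<n. if i = j div 2 then (if odd j then 2 * coeff P (j div 2) else 0) else 0)"
    by (intro sum.cong refl) auto
  also have "\<dots> = (if odd j \<and> j div 2 < n then 2 * coeff P (j div 2) else 0)"
    by simp
  finally show ?thesis .
qed

lemma odd_lift_smult: "odd_lift n (smult a P) = smult a (odd_lift n P)"
  by (rule poly_eqI) (simp add: coeff_odd_lift)

lemma poly_eq_sum_degree_less:
  fixes P :: "'a :: comm_semiring_1 poly"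
  assumes "degree P + 1 \<le> n"
  shows "poly P z = (\<Sum>i<n. coeff P i * z ^ i)"
  unfolding poly_altdef
  by (rule sum.mono_neutral_left) (use assms in \<open>auto intro: le_degree\<close>)

lemma poly_odd_lift:
  assumes "degree P + 1 \<le> n"
  shows "poly (odd_lift n P) z = 2 * z * poly P (z\<^sup>2)"
  unfolding poly_eq_sum_degree_less[OF assms]
  by (simp add: odd_lift_def poly_sum poly_monom sum_distrib_left mult_ac flip: power_mult)

lemma degree_odd_lift: "n > 0 \<Longrightarrow> degree (odd_lift n P) + 1 \<le> 2 * n"
  unfolding odd_lift_def
  by (rule order.trans[OF add_right_mono[OF degree_sum_le[of _ _ "2 * n - 1"]]])
    (auto intro: order.trans[OF degree_monom_le])

lemma inj_on_odd_lift: "inj_on (odd_lift n) {P. degree P + 1 \<le> n}"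
proof (rule inj_onI)
  fix P Q assume PQ: "P \<in> {P. degree P + 1 \<le> n}" "Q \<in> {P. degree P + 1 \<le> n}" "odd_lift n P = odd_lift n Q"
  show "P = Q"
  proof (rule poly_eqI)
    fix i
    show "coeff P i = coeff Q i"
    proof (cases "i < n")
      case True
      then show ?thesis
        using arg_cong[OF PQ(3), of "\<lambda>R. coeff R (2 * i + 1)"] by (simp add: coeff_odd_lift)
    next
      case False
      then show ?thesis using PQ(1,2) by (simp add: coeff_eq_0)
    qed
  qed
qed

text \<open>The bound \<open>2 * n\<close> is \<open>k - 2\<close> on the symmetric curve, where
  \<open>k = 2n + 2\<close>. Oddness leaves the \<open>n\<close> coefficients of odd index below
  \<open>2 * n\<close>; halving them undoes the factor 2 in \<open>odd_lift\<close>.\<close>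

lemma odd_poly_eq_odd_lift:
  assumes R: "degree R \<le> 2 * n" and odd: "pcompose R [:0, -1:] = - R" and "n > 0"
  obtains P where "degree P + 1 \<le> n" "R = odd_lift n P"
proof
  define P where "P = (\<Sum>i<n. monom (coeff R (2 * i + 1) / 2) i)"
  have "degree P \<le> n - 1"
    unfolding P_def by (intro degree_sum_le) (auto intro: order.trans[OF degree_monom_le])
  then show "degree P + 1 \<le> n" using \<open>n > 0\<close> by simp
  have even: "coeff R j = 0" if "even j" for j
    using arg_cong[OF odd, of "\<lambda>p. coeff p j"] that by (simp add: coeff_pcompose_linear)
  have P: "coeff P i = coeff R (2 * i + 1) / 2" if "i < n" for i
    using that by (simp add: P_def coeff_sum)
  show "R = odd_lift n P"
  proof (rule poly_eqI)
    fix j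
    show "coeff R j = coeff (odd_lift n P) j"
    proof (cases "odd j \<and> j div 2 < n")
      case True
      then have "2 * (j div 2) + 1 = j" by simp
      then show ?thesis using True P[of "j div 2"] by (simp add: coeff_odd_lift mult.commute)
    next
      case False
      \<comment> \<open>An odd \<open>j\<close> outside the range is at least
        \<open>2 * n + 1\<close>, beyond the degree bound; the index \<open>2 * n\<close> is even
        and falls under oddness of \<open>R\<close>.\<close>
      then have "even j \<or> degree R < j" using R by presburger
      then have "coeff R j = 0" using even coeff_eq_0 by blast
      then show ?thesis using False by (auto simp: coeff_odd_lift)
    qed
  qed
qed

section \<open>The two concrete curves and their differentials\<close>

locale symmetric_hyperelliptic =
  fixes n :: nat and E :: "nat \<Rightarrow> complex"
  assumes n: "n \<ge> 1"
    and dist: "distinct (map (\<lambda>j. (E j)\<^sup>2) [1..<n + 2] @ map (\<lambda>j. (cnj (E j))\<^sup>2) [1..<n + 2])"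
    and nz: "\<forall>j \<in> {1..n + 1}. (E j)\<^sup>2 \<noteq> 0 \<and> (cnj (E j))\<^sup>2 \<noteq> 0"
begin

text \<open>The hypothesis \<open>dist\<close> makes both families of squares injective and disjoint
  from each other, which turns the product over indices into a product over a set of roots.\<close>

lemma smooth_quot: "smooth_hyperelliptic (quot_poly n E)"
proof
  define B where "B = (\<lambda>j. (E j)\<^sup>2) ` {1..n + 1}"
  define C where "C = (\<lambda>j. (cnj (E j))\<^sup>2) ` {1..n + 1}"
  have set: "set [1..<n + 2] = {1..n + 1}" by auto
  have inj: "inj_on (\<lambda>j. (E j)\<^sup>2) {1..n + 1}" "inj_on (\<lambda>j. (cnj (E j))\<^sup>2) {1..n + 1}" "B \<inter> C = {}"
    using dist unfolding distinct_append distinct_map set_map set B_def C_def by blast+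
  have "quot_poly n E = (\<Prod>j = 1..n + 1. [:- ((E j)\<^sup>2), 1:]) * (\<Prod>j = 1..n + 1. [:- ((cnj (E j))\<^sup>2), 1:])"
    by (simp only: quot_poly_def prod.distrib)
  also have "\<dots> = (\<Prod>r\<in>B. [:- r, 1:]) * (\<Prod>r\<in>C. [:- r, 1:])"
    by (simp only: B_def C_def prod.reindex[OF inj(1)] prod.reindex[OF inj(2)] o_def)
  also have "\<dots> = (\<Prod>r\<in>B \<union> C. [:- r, 1:])"
    by (rule prod.union_disjoint[symmetric]) (simp_all add: inj(3), simp_all add: B_def C_def)
  finally show "rsquarefree (quot_poly n E)"
    using rsquarefree_prod_roots[of "B \<union> C"] by (simp add: B_def C_def)
qed (use n in \<open>simp_all only: degree_quot_poly, simp_all\<close>)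

text \<open>The derivative of \<open>g(z^2)\<close> is \<open>2 z g'(z^2)\<close>. A double root
  would thus be a double root of \<open>g\<close> or lie at \<open>z = 0\<close>, and the latter is
  excluded by the nonzero branch points in \<open>nz\<close>.\<close>

lemma smooth_sym: "smooth_hyperelliptic (sym_poly n E)"
proof
  interpret smooth_hyperelliptic "quot_poly n E" by (rule smooth_quot)
  show "rsquarefree (sym_poly n E)"
    unfolding rsquarefree_roots
  proof (intro allI notI; elim conjE)
    fix z assume z: "poly (sym_poly n E) z = 0" "poly (pderiv (sym_poly n E)) z = 0"
    have "((\<lambda>z. poly (quot_poly n E) (z\<^sup>2)) has_field_derivative poly (pderiv (quot_poly n E)) (z\<^sup>2) * (2 * z)) (at z)"
      by (rule DERIV_chain2[OF poly_DERIV]) (auto intro!: derivative_eq_intros)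
    then have "poly (pderiv (quot_poly n E)) (z\<^sup>2) * (2 * z) = 0"
      using poly_DERIV[of "sym_poly n E" z] z(2) unfolding poly_sym_poly by (metis DERIV_unique)
    moreover have "poly (quot_poly n E) 0 \<noteq> 0"
      using nz by (simp add: quot_poly_def poly_prod)
    ultimately show False
      using z(1) rsquarefree rsquarefree_roots by (auto simp: poly_sym_poly)
  qed
qed (use n in \<open>simp_all only: degree_sym_poly, simp_all\<close>)

sublocale quot: smooth_hyperelliptic "quot_poly n E" by (rule smooth_quot)
sublocale sym: smooth_hyperelliptic "sym_poly n E" by (rule smooth_sym)

text \<open>These values of \<open>k\<close> give the genera \<open>n\<close> and
  \<open>2n + 1\<close>, and the degree bounds \<open>n - 1\<close> and \<open>2n\<close> for the
  polynomials \<open>P\<close>.\<close>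

lemma half_degree: "degree (quot_poly n E) div 2 = n + 1" "degree (sym_poly n E) div 2 = 2 * n + 2"
  unfolding degree_quot_poly degree_sym_poly by simp_all

text \<open>At infinity both sides vanish: the projection ramifies there, and the coefficient of
  \<open>odd_lift n P\<close> at the even index \<open>2 * n\<close> is 0.\<close>

lemma pullback_quot_proj:
  assumes "degree P + 1 \<le> n"
  shows "pullback (sym_curve n E) (quot_curve n E) quot_proj (poly_differential (quot_poly n E) P) =
    poly_differential (sym_poly n E) (odd_lift n P)"
  unfolding sym_curve_def quot_curve_def
  by (rule pullback_poly_differential[OF smooth_sym smooth_quot, where c = 1 and m = 2])
    (simp_all add: poly_sym_poly poly_odd_lift[OF assms] half_degree coeff_odd_lift
      lead_coeff_sym_poly[unfolded One_nat_def] lead_coeff_quot_poly)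

text \<open>The outer minus sign comes from \<open>dz\<close>, which the involution sends to
  \<open>- dz\<close>. Hence invariance of the differential means oddness of
  \<open>R\<close>.\<close>

lemma pullback_involution:
  "pullback (sym_curve n E) (sym_curve n E) curve_involution (poly_differential (sym_poly n E) R) =
    poly_differential (sym_poly n E) (- pcompose R [:0, -1:])"
  unfolding sym_curve_def
  by (rule pullback_poly_differential[OF smooth_sym smooth_sym, where c = "- 1" and m = 1])
    (simp_all add: poly_sym_poly half_degree coeff_pcompose_linear poly_pcompose)

lemma holomorphic_differentials_quot:
  "holomorphic_differentials (quot_curve n E) =
    poly_differential (quot_poly n E) ` {P. degree P + 1 \<le> n}"
  unfolding quot_curve_def quot.holomorphic_differentials_eq half_degree by simp

lemma invariant_differentials_sym:
  "invariant_differentials (sym_curve n E) curve_involution =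
    (\<lambda>P. poly_differential (sym_poly n E) (odd_lift n P)) ` {P. degree P + 1 \<le> n}"
proof (intro equalityI subsetI)
  fix \<omega> assume "\<omega> \<in> invariant_differentials (sym_curve n E) curve_involution"
  then obtain R where R: "degree R \<le> 2 * n" "\<omega> = poly_differential (sym_poly n E) R"
    and inv: "pullback (sym_curve n E) (sym_curve n E) curve_involution \<omega> = \<omega>"
    unfolding invariant_differentials_def sym_curve_def sym.holomorphic_differentials_eq half_degree
    by auto
  have "- pcompose R [:0, -1:] = R"
    using inv unfolding R(2) pullback_involution by (rule sym.poly_differential_inject)
  then have "pcompose R [:0, -1:] = - R" by (metis minus_minus)
  then obtain P where "degree P + 1 \<le> n" "R = odd_lift n P"
    using odd_poly_eq_odd_lift[OF R(1)] n by auto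
  then show "\<omega> \<in> (\<lambda>P. poly_differential (sym_poly n E) (odd_lift n P)) ` {P. degree P + 1 \<le> n}"
    using R(2) by blast
next
  fix \<omega> assume "\<omega> \<in> (\<lambda>P. poly_differential (sym_poly n E) (odd_lift n P)) ` {P. degree P + 1 \<le> n}"
  then obtain P where \<omega>: "\<omega> = poly_differential (sym_poly n E) (odd_lift n P)" by blast
  have "degree (odd_lift n P) + 2 \<le> 2 * n + 2"
    using degree_odd_lift[of n P] n by simp
  then have "\<omega> \<in> holomorphic_differentials (sym_curve n E)"
    unfolding \<omega> sym_curve_def sym.holomorphic_differentials_eq half_degree by blast
  moreover have "- pcompose (odd_lift n P) [:0, -1:] = odd_lift n P"
    by (rule poly_eqI) (simp add: coeff_pcompose_linear coeff_odd_lift)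
  ultimately show "\<omega> \<in> invariant_differentials (sym_curve n E) curve_involution"
    by (simp add: invariant_differentials_def \<omega> pullback_involution)
qed

lemma inj_on_lifted_differential:
  "inj_on (\<lambda>P. poly_differential (sym_poly n E) (odd_lift n P)) {P. degree P + 1 \<le> n}"
  using inj_on_odd_lift[of n] sym.poly_differential_inject unfolding inj_on_def by blast

end

theorem proposition3p1:
  fixes n :: nat and E :: "nat \<Rightarrow> complex"
  assumes "n \<ge> 1"
    and "inj_on E {1..n + 1}"
    and "\<forall>j \<in> {1..n + 1}. Re (E j) > 0 \<and> Im (E j) > 0"
    and "distinct (map (\<lambda>j. (E j)\<^sup>2) [1..<n + 2] @ map (\<lambda>j. (cnj (E j))\<^sup>2) [1..<n + 2])"
    and "\<forall>j \<in> {1..n + 1}. (E j)\<^sup>2 \<noteq> 0 \<and> (cnj (E j))\<^sup>2 \<noteq> 0"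
  shows "complex_linear_iso_onto
           (pullback (sym_curve n E) (quot_curve n E) quot_proj)
           (holomorphic_differentials (quot_curve n E))
           (invariant_differentials (sym_curve n E) curve_involution)
         \<and> diff.dim (invariant_differentials (sym_curve n E) curve_involution) = n"
proof -
  interpret symmetric_hyperelliptic n E using assms by unfold_locales
  have "n > 0" using assms(1) by simp
  let ?D = "{P :: complex poly. degree P + 1 \<le> n}"
  let ?Q = "poly_differential (quot_poly n E)"
  let ?S = "\<lambda>P. poly_differential (sym_poly n E) (odd_lift n P)"
  let ?L = "pullback (sym_curve n E) (quot_curve n E) quot_proj"
  note linear = poly_differential_add poly_differential_smult odd_lift_add odd_lift_smult
  \<comment> \<open>Both spaces are parametrised by the same polynomials \<open>?D\<close>, and
    \<open>?L (?Q P) = ?S P\<close> on them. Surjectivity is then immediate, and injectivity of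
    \<open>?L\<close> reduces to that of \<open>?S\<close>.\<close>
  have "bij_betw ?L (?Q ` ?D) (?S ` ?D)"
    unfolding bij_betw_def
  proof
    show "inj_on ?L (?Q ` ?D)"
    proof (rule inj_onI, clarify)
      fix P P' assume "degree P + 1 \<le> n" "degree P' + 1 \<le> n" "?L (?Q P) = ?L (?Q P')"
      then have "P = P'"
        using inj_onD[OF inj_on_lifted_differential, of P P'] by (simp add: pullback_quot_proj)
      then show "?Q P = ?Q P'" by simp
    qed
    show "?L ` ?Q ` ?D = ?S ` ?D"
      unfolding image_image by (rule image_cong[OF refl]) (simp add: pullback_quot_proj)
  qed
  moreover have "diff.subspace (?Q ` ?D)" "diff.subspace (?S ` ?D)"
    by (rule diff_subspace_poly_image; simp add: linear \<open>n > 0\<close>)+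
  moreover have "diff.dim (?S ` ?D) = n"
    by (rule diff_dim_poly_image) (simp_all add: linear inj_on_lifted_differential[simplified] \<open>n > 0\<close>)
  ultimately show ?thesis
    unfolding complex_linear_iso_onto_def holomorphic_differentials_quot invariant_differentials_sym
    by (simp add: pullback_add pullback_scale)
qed

end
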